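(* Let $(M,\varphi)$ be an integrable $G_2$ manifold with characteristic connection $\nabla$ and torsion 3-form $T$. The curvature $R^h$ of the $G_2$-Hull connection $\nabla^h$ is a $G_2$-instanton if and only if the torsion is closed, $dT=0$.
   Context: A $G_2$ structure on a smooth 7-manifold $M$ is a 3-form $\varphi$ which near each point has, in a suitable local coframe $e_1,\dots,e_7$, the form $\varphi=e_{127}+e_{135}-e_{146}-e_{236}-e_{245}+e_{347}+e_{567}$, where $e_{ijk}=e_i\wedge e_j\wedge e_k$. It determines a Riemannian metric $g$ and an orientation for which such coframes are oriented orthonormal; $*$ is the Hodge star and $\nabla^g$ the Levi-Civita connection. Components are taken in local orthonormal frames, $\varphi=\frac16\varphi_{ijk}e_{ijk}$, and repeated indices are summed. $(d\varphi,*\varphi)$ is the pointwise scalar product of 4-forms. The Lee form is $\theta=-\frac13*( *d\varphi\wedge\varphi)$. The $G_2$ structure is integrable if $d{*}\varphi=\theta\wedge{*}\varphi$. On an integrable $G_2$ manifold there is a unique metric connection $\nabla$ with $\nabla\varphi=0$ whose torsion $T(X,Y,Z)=g(\nabla_XY-\nabla_YX-[X,Y],Z)$ is a 3-form (the characteristic connection); $g(\nabla_XY,Z)=g(\nabla^g_XY,Z)+\frac12T(X,Y,Z)$ and $T=-*d\varphi+*(\theta\wedge\varphi)+\frac16(d\varphi,*\varphi)\varphi$. The $G_2$-Hull connection $\nabla^h$ is the metric connection with torsion $-T$: $g(\nabla^h_XY,Z)=g(\nabla^g_XY,Z)-\frac12T(X,Y,Z)$. The curvature of a connection $D$ is $R^D(X,Y)Z=[D_X,D_Y]Z-D_{[X,Y]}Z$,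 $R^D(X,Y,Z,V)=g(R^D(X,Y)Z,V)$. It is a $G_2$-instanton if $R^D_{abij}\varphi_{abk}=0$, i.e. the curvature 2-form (first pair of arguments) lies in $\mathfrak g_2\cong\Lambda^2_{14}=\{\alpha\in\Lambda^2:*(\alpha\wedge\varphi)=-\alpha\}$. *)

theory Defs
  imports "HOL-Analysis.Analysis"
begin

section \<open>Smooth maps and smooth 7-manifolds\<close>

fun Ck_on :: "nat \<Rightarrow> 'a::real_normed_vector set \<Rightarrow> ('a \<Rightarrow> 'b::real_normed_vector) \<Rightarrow> bool" where
  "Ck_on 0 S f \<longleftrightarrow> continuous_on S f"
| "Ck_on (Suc n) S f \<longleftrightarrow> (\<forall>x\<in>S. f differentiable at x) \<and>
     (\<forall>v. Ck_on n S (\<lambda>x. frechet_derivative f (at x) v))"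

text \<open>To be used on open sets only: the derivatives are two-sided.\<close>

definition smooth_on :: "'a::real_normed_vector set \<Rightarrow> ('a \<Rightarrow> 'b::real_normed_vector) \<Rightarrow> bool" where
  "smooth_on S f \<longleftrightarrow> (\<forall>n. Ck_on n S f)"

type_synonym coord7 = "real ^ 7"

text \<open>A chart is a domain together with a coordinate map, whose values off the domain are irrelevant.\<close>

type_synonym 'm chart = "'m set \<times> ('m \<Rightarrow> coord7)"

definition chart_image :: "'m chart \<Rightarrow> coord7 set" where
  "chart_image c = snd c ` fst c"

definition transition :: "'m chart \<Rightarrow> 'm chart \<Rightarrow> coord7 \<Rightarrow> coord7" where
  "transition c c' x = snd c' (inv_into (fst c) (snd c) x)"

definition overlap :: "'m chart \<Rightarrow> 'm chart \<Rightarrow> coord7 set" where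
  "overlap c c' = snd c ` (fst c \<inter> fst c')"

definition smooth_manifold7 :: "'m topology \<Rightarrow> 'm chart set \<Rightarrow> bool" where
  "smooth_manifold7 M A \<longleftrightarrow>
     Hausdorff_space M \<and> second_countable M \<and>
     (\<Union>c\<in>A. fst c) = topspace M \<and>
     (\<forall>c\<in>A. openin M (fst c) \<and> open (chart_image c) \<and>
        homeomorphic_map (subtopology M (fst c)) (top_of_set (chart_image c)) (snd c)) \<and>
     (\<forall>c\<in>A. \<forall>c'\<in>A. smooth_on (overlap c c') (transition c c'))"

section \<open>Multilinear algebra on one tangent space\<close>

text \<open>A covariant tensor of rank \<open>k\<close> is a function of lists of vectors; only its values on lists of
  length \<open>k\<close> matter.\<close>

type_synonym tensor = "coord7 list \<Rightarrow> real"

definition multilinear :: "nat \<Rightarrow> tensor \<Rightarrow> bool" where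
  "multilinear k \<alpha> \<longleftrightarrow> (\<forall>vs i. length vs = k \<longrightarrow> i < k \<longrightarrow> linear (\<lambda>v. \<alpha> (vs[i := v])))"

definition alternating :: "nat \<Rightarrow> tensor \<Rightarrow> bool" where
  "alternating k \<alpha> \<longleftrightarrow>
     (\<forall>vs i j. length vs = k \<longrightarrow> i < j \<longrightarrow> j < k \<longrightarrow> vs ! i = vs ! j \<longrightarrow> \<alpha> vs = 0)"

text \<open>Wedge products are normalised without a factor \<open>1/k!\<close>, so that
  \<open>(a \<and> b)(u, v) = a(u) b(v) - a(v) b(u)\<close> for covectors \<open>a\<close>, \<open>b\<close>.\<close>

definition covector_wedge :: "(coord7 \<Rightarrow> real) list \<Rightarrow> tensor" where
  "covector_wedge as vs =
     (\<Sum>\<sigma> | \<sigma> permutes {..<length as}. of_int (sign \<sigma>) * (\<Prod>i<length as. (as ! i) (vs ! \<sigma> i)))"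

definition wedge :: "nat \<Rightarrow> nat \<Rightarrow> tensor \<Rightarrow> tensor \<Rightarrow> tensor" where
  "wedge p q \<alpha> \<beta> vs =
     (\<Sum>\<sigma> | \<sigma> permutes {..<p + q}. of_int (sign \<sigma>) *
        \<alpha> (map (\<lambda>i. vs ! \<sigma> i) [0..<p]) * \<beta> (map (\<lambda>i. vs ! \<sigma> i) [p..<p + q])) / (fact p * fact q)"

definition orthonormal_frame :: "tensor \<Rightarrow> (7 \<Rightarrow> coord7) \<Rightarrow> bool" where
  "orthonormal_frame g e \<longleftrightarrow> (\<forall>i j. g [e i, e j] = (if i = j then 1 else 0))"

text \<open>The Hodge star on \<open>k\<close>-forms for the metric \<open>g\<close> and the volume form \<open>vol\<close>, normalised by
  \<open>\<alpha> \<and> *\<alpha> = \<bar>\<alpha>\<bar>\<^sup>2 vol\<close>. In an oriented orthonormal frame \<open>vol (map e is @ ws)\<close> is the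
  Levi-Civita symbol; the sum does not depend on the frame chosen.\<close>

definition hodge :: "tensor \<Rightarrow> tensor \<Rightarrow> nat \<Rightarrow> tensor \<Rightarrow> tensor" where
  "hodge g vol k \<alpha> ws =
     (let e = (SOME e. orthonormal_frame g e)
      in (\<Sum>is | length is = k. \<alpha> (map e is) * vol (map e is @ ws)) / fact k)"

section \<open>Tensor fields, differential forms and connections\<close>

text \<open>A tensor field on the manifold is the family of its coordinate expressions: in the chart \<open>c\<close>,
  at the point with coordinates \<open>x\<close>, tangent vectors are identified with \<open>real ^ 7\<close>.
  Expressions in different charts are related by the derivative of the transition map.\<close>

type_synonym field = "coord7 \<Rightarrow> tensor"

definition tensor_field :: "'m chart set \<Rightarrow> nat \<Rightarrow> ('m chart \<Rightarrow> field) \<Rightarrow> bool" where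
  "tensor_field A k \<alpha> \<longleftrightarrow>
     (\<forall>c\<in>A. (\<forall>x\<in>chart_image c. multilinear k (\<alpha> c x)) \<and>
        (\<forall>vs. length vs = k \<longrightarrow> smooth_on (chart_image c) (\<lambda>x. \<alpha> c x vs))) \<and>
     (\<forall>c\<in>A. \<forall>c'\<in>A. \<forall>x\<in>overlap c c'. \<forall>vs. length vs = k \<longrightarrow>
        \<alpha> c x vs =
        \<alpha> c' (transition c c' x) (map (frechet_derivative (transition c c') (at x)) vs))"

definition differential_form :: "'m chart set \<Rightarrow> nat \<Rightarrow> ('m chart \<Rightarrow> field) \<Rightarrow> bool" where
  "differential_form A k \<alpha> \<longleftrightarrow>
     tensor_field A k \<alpha> \<and> (\<forall>c\<in>A. \<forall>x\<in>chart_image c. alternating k (\<alpha> c x))"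

definition ext_deriv :: "field \<Rightarrow> field" where
  "ext_deriv \<alpha> x vs =
     (\<Sum>i<length vs. (-1) ^ i *
        frechet_derivative (\<lambda>y. \<alpha> y (take i vs @ drop (Suc i) vs)) (at x) (vs ! i))"

text \<open>A connection is given in each chart by its Christoffel symbols,
  \<open>\<Gamma> x u v = \<Gamma>\<^sup>k\<^sub>i\<^sub>j(x) u\<^sup>i v\<^sup>j \<partial>\<^sub>k\<close>. The transformation law says that the covariant derivative
  of a vector field is again a vector field.\<close>

type_synonym christoffel = "coord7 \<Rightarrow> coord7 \<Rightarrow> coord7 \<Rightarrow> coord7"

definition connection :: "'m chart set \<Rightarrow> ('m chart \<Rightarrow> christoffel) \<Rightarrow> bool" where
  "connection A \<Gamma> \<longleftrightarrow>
     (\<forall>c\<in>A. (\<forall>x\<in>chart_image c. bilinear (\<Gamma> c x)) \<and>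
        (\<forall>u v. smooth_on (chart_image c) (\<lambda>x. \<Gamma> c x u v))) \<and>
     (\<forall>c\<in>A. \<forall>c'\<in>A. \<forall>x\<in>overlap c c'. \<forall>u v.
        (let D = (\<lambda>y. frechet_derivative (transition c c') (at y))
         in D x (\<Gamma> c x u v) =
            frechet_derivative (\<lambda>y. D y v) (at x) u + \<Gamma> c' (transition c c' x) (D x u) (D x v)))"

definition cov_deriv :: "christoffel \<Rightarrow> (coord7 \<Rightarrow> coord7) \<Rightarrow> (coord7 \<Rightarrow> coord7) \<Rightarrow> coord7 \<Rightarrow> coord7" where
  "cov_deriv \<Gamma> X Y x = frechet_derivative Y (at x) (X x) + \<Gamma> x (X x) (Y x)"

definition lie_bracket :: "(coord7 \<Rightarrow> coord7) \<Rightarrow> (coord7 \<Rightarrow> coord7) \<Rightarrow> coord7 \<Rightarrow> coord7" where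
  "lie_bracket X Y x = frechet_derivative Y (at x) (X x) - frechet_derivative X (at x) (Y x)"

definition torsion :: "christoffel \<Rightarrow> (coord7 \<Rightarrow> coord7) \<Rightarrow> (coord7 \<Rightarrow> coord7) \<Rightarrow> coord7 \<Rightarrow> coord7" where
  "torsion \<Gamma> X Y x = cov_deriv \<Gamma> X Y x - cov_deriv \<Gamma> Y X x - lie_bracket X Y x"

definition curvature ::
    "christoffel \<Rightarrow> (coord7 \<Rightarrow> coord7) \<Rightarrow> (coord7 \<Rightarrow> coord7) \<Rightarrow> (coord7 \<Rightarrow> coord7) \<Rightarrow> coord7 \<Rightarrow> coord7" where
  "curvature \<Gamma> X Y Z x =
     cov_deriv \<Gamma> X (cov_deriv \<Gamma> Y Z) x - cov_deriv \<Gamma> Y (cov_deriv \<Gamma> X Z) x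
     - cov_deriv \<Gamma> (lie_bracket X Y) Z x"

text \<open>Torsion, curvature and covariant derivatives of tensor fields are tensorial, so their values
  at a point can be computed by extending tangent vectors to constant vector fields in the chart.\<close>

definition torsion_tensor :: "field \<Rightarrow> christoffel \<Rightarrow> field" where
  "torsion_tensor g \<Gamma> x vs = g x [torsion \<Gamma> (\<lambda>_. vs ! 0) (\<lambda>_. vs ! 1) x, vs ! 2]"

definition curvature_tensor :: "field \<Rightarrow> christoffel \<Rightarrow> coord7 \<Rightarrow> coord7 \<Rightarrow> coord7 \<Rightarrow> coord7 \<Rightarrow> coord7 \<Rightarrow> real" where
  "curvature_tensor g \<Gamma> x u v z w = g x [curvature \<Gamma> (\<lambda>_. u) (\<lambda>_. v) (\<lambda>_. z) x, w]"

definition cov_deriv_tensor :: "christoffel \<Rightarrow> field \<Rightarrow> coord7 \<Rightarrow> coord7 \<Rightarrow> tensor" where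
  "cov_deriv_tensor \<Gamma> \<alpha> x u vs =
     frechet_derivative (\<lambda>y. \<alpha> y vs) (at x) u
     - (\<Sum>i<length vs. \<alpha> x (vs[i := cov_deriv \<Gamma> (\<lambda>_. u) (\<lambda>_. vs ! i) x]))"

definition parallel :: "'m chart set \<Rightarrow> ('m chart \<Rightarrow> christoffel) \<Rightarrow> nat \<Rightarrow> ('m chart \<Rightarrow> field) \<Rightarrow> bool" where
  "parallel A \<Gamma> k \<alpha> \<longleftrightarrow>
     (\<forall>c\<in>A. \<forall>x\<in>chart_image c. \<forall>u vs. length vs = k \<longrightarrow> cov_deriv_tensor (\<Gamma> c) (\<alpha> c) x u vs = 0)"

definition metric_connection ::
    "'m chart set \<Rightarrow> ('m chart \<Rightarrow> field) \<Rightarrow> ('m chart \<Rightarrow> christoffel) \<Rightarrow> bool" where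
  "metric_connection A g \<Gamma> \<longleftrightarrow> connection A \<Gamma> \<and> parallel A \<Gamma> 2 g"

definition closed_form :: "'m chart set \<Rightarrow> nat \<Rightarrow> ('m chart \<Rightarrow> field) \<Rightarrow> bool" where
  "closed_form A k \<alpha> \<longleftrightarrow>
     (\<forall>c\<in>A. \<forall>x\<in>chart_image c. \<forall>vs. length vs = Suc k \<longrightarrow> ext_deriv (\<alpha> c) x vs = 0)"

section \<open>\<open>G\<^sub>2\<close> structures\<close>

text \<open>A coframe is indexed by the type \<open>7\<close>, in which the numeral \<open>7\<close> denotes \<open>0\<close>;
  thus \<open>1, \<dots>, 7\<close> are its seven distinct elements.\<close>

definition coframe :: "(7 \<Rightarrow> coord7 \<Rightarrow> real) \<Rightarrow> bool" where
  "coframe e \<longleftrightarrow> (\<forall>i. linear (e i)) \<and> (\<forall>v. (\<forall>i. e i v = 0) \<longrightarrow> v = 0)"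

definition g2_standard :: "(7 \<Rightarrow> coord7 \<Rightarrow> real) \<Rightarrow> tensor" where
  "g2_standard e vs =
     covector_wedge [e 1, e 2, e 7] vs + covector_wedge [e 1, e 3, e 5] vs
     - covector_wedge [e 1, e 4, e 6] vs - covector_wedge [e 2, e 3, e 6] vs
     - covector_wedge [e 2, e 4, e 5] vs + covector_wedge [e 3, e 4, e 7] vs
     + covector_wedge [e 5, e 6, e 7] vs"

definition adapted_coframe :: "tensor \<Rightarrow> (7 \<Rightarrow> coord7 \<Rightarrow> real) \<Rightarrow> bool" where
  "adapted_coframe \<phi> e \<longleftrightarrow> coframe e \<and> (\<forall>vs. length vs = 3 \<longrightarrow> \<phi> vs = g2_standard e vs)"

definition g2_structure :: "'m chart set \<Rightarrow> ('m chart \<Rightarrow> field) \<Rightarrow> bool" where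
  "g2_structure A \<phi> \<longleftrightarrow> differential_form A 3 \<phi> \<and>
     (\<forall>c\<in>A. \<forall>x\<in>chart_image c. \<exists>N e. open N \<and> x \<in> N \<and> N \<subseteq> chart_image c \<and>
        (\<forall>i v. smooth_on N (\<lambda>y. e y i v)) \<and> (\<forall>y\<in>N. adapted_coframe (\<phi> c y) (e y)))"

text \<open>\<open>g\<close> and \<open>vol\<close> are the Riemannian metric and the oriented volume form determined by \<open>\<phi>\<close>:
  those for which every adapted coframe is oriented orthonormal. They exist since the stabiliser of
  the standard 3-form is contained in \<open>SO(7)\<close>, and they are unique since adapted coframes exist at
  every point.\<close>

definition g2_metric_volume ::
    "'m chart set \<Rightarrow> ('m chart \<Rightarrow> field) \<Rightarrow> ('m chart \<Rightarrow> field) \<Rightarrow> ('m chart \<Rightarrow> field) \<Rightarrow> bool" where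
  "g2_metric_volume A \<phi> g vol \<longleftrightarrow>
     (\<forall>c\<in>A. \<forall>x\<in>chart_image c. \<forall>e. adapted_coframe (\<phi> c x) e \<longrightarrow>
        (\<forall>u v. g c x [u, v] = (\<Sum>i\<in>UNIV. e i u * e i v)) \<and>
        (\<forall>vs. length vs = 7 \<longrightarrow>
           vol c x vs = covector_wedge [e 1, e 2, e 3, e 4, e 5, e 6, e 7] vs))"

definition lee_form :: "field \<Rightarrow> field \<Rightarrow> field \<Rightarrow> field" where
  "lee_form g vol \<phi> x vs =
     - (1/3) * hodge (g x) (vol x) 6
        (wedge 3 3 (hodge (g x) (vol x) 4 (ext_deriv \<phi> x)) (\<phi> x)) vs"

definition integrable_g2 ::
    "'m chart set \<Rightarrow> ('m chart \<Rightarrow> field) \<Rightarrow> ('m chart \<Rightarrow> field) \<Rightarrow> ('m chart \<Rightarrow> field) \<Rightarrow> bool" where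
  "integrable_g2 A \<phi> g vol \<longleftrightarrow>
     (\<forall>c\<in>A. \<forall>x\<in>chart_image c. \<forall>vs. length vs = 5 \<longrightarrow>
        ext_deriv (\<lambda>y. hodge (g c y) (vol c y) 3 (\<phi> c y)) x vs =
        wedge 1 4 (lee_form (g c) (vol c) (\<phi> c) x) (hodge (g c x) (vol c x) 3 (\<phi> c x)) vs)"

definition characteristic_connection ::
    "'m chart set \<Rightarrow> ('m chart \<Rightarrow> field) \<Rightarrow> ('m chart \<Rightarrow> field) \<Rightarrow> ('m chart \<Rightarrow> christoffel)
     \<Rightarrow> ('m chart \<Rightarrow> field) \<Rightarrow> bool" where
  "characteristic_connection A \<phi> g \<Gamma> T \<longleftrightarrow>
     metric_connection A g \<Gamma> \<and> parallel A \<Gamma> 3 \<phi> \<and> differential_form A 3 T \<and>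
     (\<forall>c\<in>A. \<forall>x\<in>chart_image c. \<forall>vs. length vs = 3 \<longrightarrow> torsion_tensor (g c) (\<Gamma> c) x vs = T c x vs)"

definition g2_hull_connection ::
    "'m chart set \<Rightarrow> ('m chart \<Rightarrow> field) \<Rightarrow> ('m chart \<Rightarrow> field) \<Rightarrow> ('m chart \<Rightarrow> christoffel) \<Rightarrow> bool" where
  "g2_hull_connection A g T \<Gamma>h \<longleftrightarrow>
     metric_connection A g \<Gamma>h \<and>
     (\<forall>c\<in>A. \<forall>x\<in>chart_image c. \<forall>vs. length vs = 3 \<longrightarrow> torsion_tensor (g c) (\<Gamma>h c) x vs = - T c x vs)"

definition g2_instanton ::
    "'m chart set \<Rightarrow> ('m chart \<Rightarrow> field) \<Rightarrow> ('m chart \<Rightarrow> field) \<Rightarrow> ('m chart \<Rightarrow> christoffel) \<Rightarrow> bool" where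
  "g2_instanton A \<phi> g \<Gamma> \<longleftrightarrow>
     (\<forall>c\<in>A. \<forall>x\<in>chart_image c. \<forall>e. orthonormal_frame (g c x) e \<longrightarrow>
        (\<forall>i j k. (\<Sum>a\<in>UNIV. \<Sum>b\<in>UNIV.
           curvature_tensor (g c) (\<Gamma> c) x (e a) (e b) (e i) (e j) * \<phi> c x [e a, e b, e k]) = 0))"

end

theory Submission
  imports Defs
begin

text \<open>
  Write \<open>\<langle>\<nabla>\<^sub>u v, w\<rangle>\<close> for the Christoffel symbols of \<open>\<nabla>\<close>, lowered with \<open>g\<close>. Since a metric connection with
  skew torsion is determined by its torsion, the Christoffel symbols of \<open>\<nabla>\<^sup>h\<close> are those of \<open>\<nabla>\<close> with
  the lower arguments exchanged. Comparing coordinate expressions, the terms quadratic in the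
  Christoffel symbols cancel and \<open>R(u, v, z, w) - R\<^sup>h(z, w, u, v) = dT(u, v, z, w) / 2\<close>, by the symmetry of
  the second derivatives of \<open>g\<close>. As \<open>\<phi>\<close> is \<open>\<nabla>\<close>-parallel, the last two arguments of \<open>R\<close> lie in the
  Lie algebra of the stabiliser of \<open>\<phi>\<close>, that is, their contraction with \<open>\<phi>\<close> vanishes. Hence the
  contraction of \<open>R\<^sup>h\<close> that defines an instanton is, up to a factor, the contraction of two
  arguments of \<open>dT\<close> with \<open>\<phi>\<close>; and a 4-form all of whose contractions with \<open>\<phi>\<close> vanish is zero.
\<close>

section \<open>Calculus\<close>

text \<open>The second difference is the increment over \<open>[0, t]\<close> of the function
  \<open>p\<close> below. The mean value theorem turns it into \<open>t\<close> times a difference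
  of values of the \<open>u\<close>-derivative of \<open>f\<close>, and the first-order expansion of
  that derivative at \<open>x\<close> gives the limit.\<close>

lemma second_difference_limit:
  fixes f :: "'a::real_normed_vector \<Rightarrow> real"
  assumes U: "open U" "x \<in> U" and f: "\<And>y. y \<in> U \<Longrightarrow> f differentiable at y"
    and fu: "(\<lambda>y. frechet_derivative f (at y) u) differentiable at x"
  shows "((\<lambda>t. (f (x + t *\<^sub>R u + t *\<^sub>R v) - f (x + t *\<^sub>R u) - f (x + t *\<^sub>R v) + f x) / t\<^sup>2) \<longlongrightarrow>
           frechet_derivative (\<lambda>y. frechet_derivative f (at y) u) (at x) v) (at_right 0)"
proof -
  define F where "F y = frechet_derivative f (at y) u" for y
  define D where "D = frechet_derivative F (at x)"
  have D: "(F has_derivative D) (at x)"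
    using fu unfolding F_def D_def frechet_derivative_works .
  then have lin: "linear D" by (rule has_derivative_linear)
  let ?K = "norm u + norm v + 1"
  have "\<forall>\<^sub>F t in at_right 0. dist ((f (x + t *\<^sub>R u + t *\<^sub>R v) - f (x + t *\<^sub>R u) - f (x + t *\<^sub>R v) + f x) / t\<^sup>2) (D v) < e"
    if e: "e > 0" for e
  proof -
    \<comment> \<open>\<open>t * ?K\<close> bounds the norms of both displacements used below. The
      two expansion errors then add up to at most two thirds of \<open>t * e\<close>, which leaves
      room for a strict inequality.\<close>
    define e' where "e' = e / (3 * ?K)"
    have K: "?K > 0" using norm_ge_zero[of u] norm_ge_zero[of v] by linarith
    have e': "e' > 0" using e K by (simp add: e'_def)
    obtain d1 where d1: "d1 > 0" "\<And>h. norm h < d1 \<Longrightarrow> norm (F (x + h) - F x - D h) \<le> e' * norm h"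
    proof -
      from D[unfolded has_derivative_at_alt] e' obtain d where "d > 0"
        "\<And>y. norm (y - x) < d \<Longrightarrow> norm (F y - F x - D (y - x)) \<le> e' * norm (y - x)" by blast
      then show ?thesis using that[of d] by (metis add_diff_cancel_left')
    qed
    obtain d2 where d2: "d2 > 0" "ball x d2 \<subseteq> U" using U openE by blast
    define d where "d = min d1 d2 / ?K"
    have d: "d > 0" using d1 d2 K by (simp add: d_def)
    have "dist ((f (x + t *\<^sub>R u + t *\<^sub>R v) - f (x + t *\<^sub>R u) - f (x + t *\<^sub>R v) + f x) / t\<^sup>2) (D v) < e"
      if t: "0 < t" "t < d" for t
    proof -
      have tK: "t * ?K < min d1 d2" using t K by (simp add: d_def field_simps)
      have n1: "norm (s *\<^sub>R u) \<le> t * ?K" if "0 \<le> s" "s \<le> t" for s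
      proof -
        have "s * norm u \<le> t * ?K" using that t norm_ge_zero[of u] norm_ge_zero[of v] by (intro mult_mono) auto
        then show ?thesis using that by simp
      qed
      have n2: "norm (s *\<^sub>R u + t *\<^sub>R v) \<le> t * ?K" if "0 \<le> s" "s \<le> t" for s
      proof -
        have "norm (s *\<^sub>R u + t *\<^sub>R v) \<le> s * norm u + t * norm v"
          using norm_triangle_ineq[of "s *\<^sub>R u" "t *\<^sub>R v"] that t by simp
        also have "\<dots> \<le> t * norm u + t * norm v" using that by (simp add: mult_right_mono)
        also have "\<dots> \<le> t * ?K" using t by (simp add: algebra_simps)
        finally show ?thesis .
      qed
      have inU: "x + h \<in> U" if "norm h \<le> t * ?K" for h
        using that tK d2(2) by (auto simp: dist_norm subset_iff)
      define p where "p s = f (x + (s *\<^sub>R u + t *\<^sub>R v)) - f (x + s *\<^sub>R u)" for s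
      have dp: "(p has_real_derivative F (x + (s *\<^sub>R u + t *\<^sub>R v)) - F (x + s *\<^sub>R u)) (at s)"
        if s: "0 \<le> s" "s \<le> t" for s
      proof -
        have chain: "((\<lambda>s. f (x + (s *\<^sub>R u + w))) has_real_derivative F (x + (s *\<^sub>R u + w))) (at s)"
          if "x + (s *\<^sub>R u + w) \<in> U" for w
        proof -
          have fd: "(f has_derivative frechet_derivative f (at (x + (s *\<^sub>R u + w)))) (at (x + (s *\<^sub>R u + w)))"
            using f[OF that] frechet_derivative_works by blast
          have "((\<lambda>s. x + (s *\<^sub>R u + w)) has_derivative (\<lambda>h. h *\<^sub>R u)) (at s)"
            by (auto intro!: derivative_eq_intros)
          from diff_chain_at[OF this fd]
          have "((\<lambda>s. f (x + (s *\<^sub>R u + w))) has_derivative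
              (\<lambda>h. frechet_derivative f (at (x + (s *\<^sub>R u + w))) (h *\<^sub>R u))) (at s)"
            by (simp add: o_def)
          moreover have "frechet_derivative f (at (x + (s *\<^sub>R u + w))) (h *\<^sub>R u) = h * F (x + (s *\<^sub>R u + w))" for h
            using has_derivative_linear[OF fd] by (simp add: linear_scale F_def)
          ultimately show ?thesis by (simp add: has_field_derivative_def mult.commute[of _ "F _"])
        qed
        show ?thesis unfolding p_def
          using chain[of "t *\<^sub>R v"] chain[of 0] inU[OF n1[OF s]] inU[OF n2[OF s]]
          by (auto intro!: derivative_intros)
      qed
      obtain s where s: "0 < s" "s < t" "p t - p 0 = (t - 0) * (F (x + (s *\<^sub>R u + t *\<^sub>R v)) - F (x + s *\<^sub>R u))"
        using MVT2[OF t(1), of p "\<lambda>s. F (x + (s *\<^sub>R u + t *\<^sub>R v)) - F (x + s *\<^sub>R u)"] dp by blast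
      have b1: "norm (F (x + (s *\<^sub>R u + t *\<^sub>R v)) - F x - D (s *\<^sub>R u + t *\<^sub>R v)) \<le> e' * (t * ?K)"
      proof -
        have "norm (s *\<^sub>R u + t *\<^sub>R v) \<le> t * ?K" using n2[of s] s by simp
        then show ?thesis using d1(2)[of "s *\<^sub>R u + t *\<^sub>R v"] tK e'
          by (smt (verit) mult_left_mono)
      qed
      have b2: "norm (F (x + s *\<^sub>R u) - F x - D (s *\<^sub>R u)) \<le> e' * (t * ?K)"
      proof -
        have "norm (s *\<^sub>R u) \<le> t * ?K" using n1[of s] s by simp
        then show ?thesis using d1(2)[of "s *\<^sub>R u"] tK e'
          by (smt (verit) mult_left_mono)
      qed
      \<comment> \<open>The intermediate point \<open>s\<close> of the mean value theorem is
        unknown; it drops out because \<open>D\<close> is linear.\<close>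
      have "D (s *\<^sub>R u + t *\<^sub>R v) - D (s *\<^sub>R u) = t * D v"
        using lin by (simp add: linear_add linear_scale)
      then have "\<bar>F (x + (s *\<^sub>R u + t *\<^sub>R v)) - F (x + s *\<^sub>R u) - t * D v\<bar> \<le> 2 * (e' * (t * ?K))"
        using b1 b2 unfolding real_norm_def by linarith
      also have "\<dots> = t * (2 / 3 * e)" using K unfolding e'_def by (simp add: divide_simps)
      also have "\<dots> < t * e" using t e by simp
      finally have "\<bar>F (x + (s *\<^sub>R u + t *\<^sub>R v)) - F (x + s *\<^sub>R u) - t * D v\<bar> < t * e" .
      then have "t * \<bar>F (x + (s *\<^sub>R u + t *\<^sub>R v)) - F (x + s *\<^sub>R u) - t * D v\<bar> < t * (t * e)"
        using t by simp
      then have "\<bar>p t - p 0 - t\<^sup>2 * D v\<bar> < t\<^sup>2 * e"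
        using s(3) t by (simp add: power2_eq_square abs_mult[symmetric] abs_mult_pos' algebra_simps)
      moreover have "p t - p 0 = f (x + t *\<^sub>R u + t *\<^sub>R v) - f (x + t *\<^sub>R u) - f (x + t *\<^sub>R v) + f x"
        by (simp add: p_def add.assoc)
      moreover have "\<bar>a / t\<^sup>2 - D v\<bar> < e" if "\<bar>a - t\<^sup>2 * D v\<bar> < t\<^sup>2 * e" for a
      proof -
        have "(a / t\<^sup>2 - D v) * t\<^sup>2 = a - t\<^sup>2 * D v" using t by (simp add: field_simps)
        then have "\<bar>a / t\<^sup>2 - D v\<bar> * t\<^sup>2 < e * t\<^sup>2"
          using that t by (metis abs_mult abs_power2 mult.commute)
        then show ?thesis using t by simp
      qed
      ultimately show ?thesis by (simp add: dist_real_def)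
    qed
    then show ?thesis using d unfolding eventually_at_right_field by auto
  qed
  then have "((\<lambda>t. (f (x + t *\<^sub>R u + t *\<^sub>R v) - f (x + t *\<^sub>R u) - f (x + t *\<^sub>R v) + f x) / t\<^sup>2) \<longlongrightarrow> D v) (at_right 0)"
    by (rule tendstoI)
  then show ?thesis by (simp add: D_def F_def[abs_def])
qed

text \<open>The second difference is symmetric in \<open>u\<close> and \<open>v\<close>, so both
  mixed derivatives are limits of the same quotient.\<close>

lemma second_derivative_symmetric:
  fixes f :: "'a::real_normed_vector \<Rightarrow> real"
  assumes "open U" "x \<in> U" "\<And>y. y \<in> U \<Longrightarrow> f differentiable at y"
    and "\<And>u. (\<lambda>y. frechet_derivative f (at y) u) differentiable at x"
  shows "frechet_derivative (\<lambda>y. frechet_derivative f (at y) u) (at x) v =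
         frechet_derivative (\<lambda>y. frechet_derivative f (at y) v) (at x) u"
proof (rule tendsto_unique)
  show "((\<lambda>t. (f (x + t *\<^sub>R u + t *\<^sub>R v) - f (x + t *\<^sub>R u) - f (x + t *\<^sub>R v) + f x) / t\<^sup>2) \<longlongrightarrow>
           frechet_derivative (\<lambda>y. frechet_derivative f (at y) u) (at x) v) (at_right 0)"
    by (rule second_difference_limit) (use assms in auto)
  have "((\<lambda>t. (f (x + t *\<^sub>R v + t *\<^sub>R u) - f (x + t *\<^sub>R v) - f (x + t *\<^sub>R u) + f x) / t\<^sup>2) \<longlongrightarrow>
           frechet_derivative (\<lambda>y. frechet_derivative f (at y) v) (at x) u) (at_right 0)"
    by (rule second_difference_limit) (use assms in auto)
  then show "((\<lambda>t. (f (x + t *\<^sub>R u + t *\<^sub>R v) - f (x + t *\<^sub>R u) - f (x + t *\<^sub>R v) + f x) / t\<^sup>2) \<longlongrightarrow>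
           frechet_derivative (\<lambda>y. frechet_derivative f (at y) v) (at x) u) (at_right 0)"
    by (simp add: algebra_simps)
qed simp

section \<open>Local transfer of derivatives and the product rule for linear arguments\<close>

lemma differentiable_cong_open:
  assumes "open U" "x \<in> U" "\<And>y. y \<in> U \<Longrightarrow> f y = h y" "f differentiable at x"
  shows "h differentiable at x"
  using assms has_derivative_transform_within_open[of f _ x UNIV U h]
  unfolding differentiable_def by blast

lemma frechet_derivative_cong_open:
  assumes "open U" "x \<in> U" "\<And>y. y \<in> U \<Longrightarrow> f y = h y"
  shows "frechet_derivative f (at x) = frechet_derivative h (at x)"
proof -
  have "(f has_derivative D) (at x) \<longleftrightarrow> (h has_derivative D) (at x)" for D
    using has_derivative_transform_within_open[of f D x UNIV U h]
      has_derivative_transform_within_open[of h D x UNIV U f] assms by auto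
  then show ?thesis by (simp add: frechet_derivative_def)
qed

text \<open>The product rule for a tensor applied to a vector field. Expanding the argument in a
  basis reduces it to finitely many products of real functions, so it is enough that
  \<open>F\<close> is differentiable for each fixed argument.\<close>

lemma has_derivative_linear_slot:
  fixes F :: "'a::real_normed_vector \<Rightarrow> 'b::euclidean_space \<Rightarrow> real"
  assumes U: "open U" "x \<in> U" and lin: "\<And>y. y \<in> U \<Longrightarrow> linear (F y)"
    and F: "\<And>v. (\<lambda>y. F y v) differentiable at x" and X: "X differentiable at x"
  shows "((\<lambda>y. F y (X y)) has_derivative
          (\<lambda>h. frechet_derivative (\<lambda>y. F y (X x)) (at x) h + F x (frechet_derivative X (at x) h))) (at x)"
proof -
  have expand: "F y w = (\<Sum>b\<in>Basis. (w \<bullet> b) * F y b)" if "y \<in> U" for y w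
  proof -
    have "F y (\<Sum>b\<in>Basis. (w \<bullet> b) *\<^sub>R b) = (\<Sum>b\<in>Basis. (w \<bullet> b) * F y b)"
      using lin[OF that] by (simp add: linear_sum linear_scale)
    then show ?thesis by (simp add: euclidean_representation)
  qed
  have F': "((\<lambda>y. F y v) has_derivative frechet_derivative (\<lambda>y. F y v) (at x)) (at x)" for v
    using F frechet_derivative_works by blast
  have X': "(X has_derivative frechet_derivative X (at x)) (at x)"
    using X frechet_derivative_works by blast
  \<comment> \<open>Stated for every \<open>Y\<close>: a constant \<open>Y\<close> identifies the
    sum as the derivative with the argument frozen at \<open>X x\<close>, and \<open>Y = X\<close>
    then gives the claim.\<close>
  have gen: "((\<lambda>y. F y (Y y)) has_derivative
      (\<lambda>h. (\<Sum>b\<in>Basis. (Y x \<bullet> b) * frechet_derivative (\<lambda>y. F y b) (at x) h) + F x (Y' h))) (at x)"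
    if Y: "(Y has_derivative Y') (at x)" for Y Y'
  proof -
    have "((\<lambda>y. \<Sum>b\<in>Basis. (Y y \<bullet> b) * F y b) has_derivative
       (\<lambda>h. \<Sum>b\<in>Basis. (Y x \<bullet> b) * frechet_derivative (\<lambda>y. F y b) (at x) h + (Y' h \<bullet> b) * F x b)) (at x)"
      by (intro has_derivative_sum has_derivative_mult has_derivative_inner_left Y F')
    then have "((\<lambda>y. F y (Y y)) has_derivative
       (\<lambda>h. \<Sum>b\<in>Basis. (Y x \<bullet> b) * frechet_derivative (\<lambda>y. F y b) (at x) h + (Y' h \<bullet> b) * F x b)) (at x)"
      by (rule has_derivative_transform_within_open[OF _ U]) (simp add: expand)
    then show ?thesis by (simp add: sum.distrib flip: expand[OF U(2)])
  qed
  have "frechet_derivative (\<lambda>y. F y (X x)) (at x) =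
      (\<lambda>h. \<Sum>b\<in>Basis. (X x \<bullet> b) * frechet_derivative (\<lambda>y. F y b) (at x) h)"
    using gen[OF has_derivative_const[of "X x"]] linear_0[OF lin[OF U(2)]]
    by (intro frechet_derivative_at[symmetric]) simp
  with gen[OF X'] show ?thesis by simp
qed

lemma frechet_derivative_linear_slot:
  fixes F :: "'a::real_normed_vector \<Rightarrow> 'b::real_vector \<Rightarrow> real"
  assumes U: "open U" "x \<in> U" and lin: "\<And>y. y \<in> U \<Longrightarrow> linear (F y)"
    and F: "\<And>v. (\<lambda>y. F y v) differentiable at x"
  shows "linear (\<lambda>v. frechet_derivative (\<lambda>y. F y v) (at x) h)"
proof
  have F': "((\<lambda>y. F y v) has_derivative frechet_derivative (\<lambda>y. F y v) (at x)) (at x)" for v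
    using F frechet_derivative_works by blast
  fix v w and r :: real
  have "((\<lambda>y. F y (v + w)) has_derivative
     (\<lambda>h. frechet_derivative (\<lambda>y. F y v) (at x) h + frechet_derivative (\<lambda>y. F y w) (at x) h)) (at x)"
    by (rule has_derivative_transform_within_open[OF has_derivative_add[OF F' F'] U])
      (simp add: linear_add[OF lin])
  from frechet_derivative_at[OF this]
  show "frechet_derivative (\<lambda>y. F y (v + w)) (at x) h =
      frechet_derivative (\<lambda>y. F y v) (at x) h + frechet_derivative (\<lambda>y. F y w) (at x) h" by metis
  have "((\<lambda>y. F y (r *\<^sub>R v)) has_derivative (\<lambda>h. r *\<^sub>R frechet_derivative (\<lambda>y. F y v) (at x) h)) (at x)"
    by (rule has_derivative_transform_within_open[OF has_derivative_scaleR_right[OF F'] U])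
      (simp add: linear_scale[OF lin])
  from frechet_derivative_at[OF this]
  show "frechet_derivative (\<lambda>y. F y (r *\<^sub>R v)) (at x) h = r *\<^sub>R frechet_derivative (\<lambda>y. F y v) (at x) h" by metis
qed

lemma smooth_on_differentiable: "smooth_on S f \<Longrightarrow> x \<in> S \<Longrightarrow> f differentiable at x"
  unfolding smooth_on_def by (metis Ck_on.simps(2))

lemma smooth_on_frechet_derivative:
  "smooth_on S f \<Longrightarrow> smooth_on S (\<lambda>x. frechet_derivative f (at x) v)"
  unfolding smooth_on_def by (metis Ck_on.simps(2))

section \<open>Connections in a chart\<close>

text \<open>The usual coordinate formula for the curvature; constant fields commute, so it has no
  bracket term.\<close>

definition curvature_const :: "christoffel \<Rightarrow> coord7 \<Rightarrow> coord7 \<Rightarrow> coord7 \<Rightarrow> coord7 \<Rightarrow> coord7" where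
  "curvature_const \<Gamma> x u v z =
     frechet_derivative (\<lambda>y. \<Gamma> y v z) (at x) u + \<Gamma> x u (\<Gamma> x v z)
     - (frechet_derivative (\<lambda>y. \<Gamma> y u z) (at x) v + \<Gamma> x v (\<Gamma> x u z))"

lemma cov_deriv_const: "cov_deriv \<Gamma> (\<lambda>_. u) (\<lambda>_. v) = (\<lambda>x. \<Gamma> x u v)"
  by (simp add: fun_eq_iff cov_deriv_def frechet_derivative_const)

lemma lie_bracket_const: "lie_bracket (\<lambda>_. u) (\<lambda>_. v) = (\<lambda>_. 0)"
  by (simp add: fun_eq_iff lie_bracket_def frechet_derivative_const)

lemma curvature_const:
  assumes "bilinear (\<Gamma> x)"
  shows "curvature \<Gamma> (\<lambda>_. u) (\<lambda>_. v) (\<lambda>_. z) x = curvature_const \<Gamma> x u v z"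
  by (simp add: curvature_def curvature_const_def lie_bracket_const cov_deriv_const)
     (simp add: cov_deriv_def bilinear_lzero[OF assms] frechet_derivative_const)

lemma multilinear_slot: "multilinear k \<alpha> \<Longrightarrow> length vs = k \<Longrightarrow> i < k \<Longrightarrow> linear (\<lambda>v. \<alpha> (vs[i := v]))"
  by (simp add: multilinear_def)

section \<open>A metric connection in one chart\<close>

text \<open>The local data are isolated so that both connections can be interpreted over the same
  \<open>U\<close> and \<open>g\<close> and then compared. Linearity of \<open>g\<close> in its
  second argument follows from symmetry; definiteness serves to recover vectors from their inner
  products.\<close>

locale chart_metric_connection =
  fixes U :: "coord7 set" and g :: field and \<Gamma> :: christoffel
  assumes open_U: "open U"
    and g_linear: "y \<in> U \<Longrightarrow> linear (\<lambda>u. g y [u, v])"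
    and g_sym: "y \<in> U \<Longrightarrow> g y [u, v] = g y [v, u]"
    and g_pos: "y \<in> U \<Longrightarrow> g y [u, u] = 0 \<Longrightarrow> u = 0"
    and g_diff: "y \<in> U \<Longrightarrow> (\<lambda>y. g y [u, v]) differentiable at y"
    and \<Gamma>_bilinear: "y \<in> U \<Longrightarrow> bilinear (\<Gamma> y)"
    and \<Gamma>_diff: "y \<in> U \<Longrightarrow> (\<lambda>y. \<Gamma> y u v) differentiable at y"
    and metric: "y \<in> U \<Longrightarrow> cov_deriv_tensor \<Gamma> g y u [v, w] = 0"
begin

text \<open>Christoffel symbols of the first kind. The point comes last, so that fixing the vectors
  leaves a function to differentiate.\<close>

definition lowered :: "coord7 \<Rightarrow> coord7 \<Rightarrow> coord7 \<Rightarrow> coord7 \<Rightarrow> real" where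
  "lowered u v w y = g y [\<Gamma> y u v, w]"

definition dlowered :: "coord7 \<Rightarrow> coord7 \<Rightarrow> coord7 \<Rightarrow> coord7 \<Rightarrow> coord7 \<Rightarrow> real" where
  "dlowered x u v z w = frechet_derivative (lowered v z w) (at x) u"

lemma g_deriv:
  assumes "y \<in> U"
  shows "frechet_derivative (\<lambda>y. g y [v, w]) (at y) u = lowered u v w y + lowered u w v y"
  using metric[OF assms, of u v w] g_sym[OF assms]
  by (simp add: cov_deriv_tensor_def cov_deriv_const lowered_def lessThan_Suc numeral_2_eq_2)

lemma lowered_has_derivative:
  assumes "x \<in> U"
  shows "(lowered v z w has_derivative
     (\<lambda>h. lowered h (\<Gamma> x v z) w x + g x [\<Gamma> x v z, \<Gamma> x h w]
        + g x [frechet_derivative (\<lambda>y. \<Gamma> y v z) (at x) h, w])) (at x)"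
proof -
  have "((\<lambda>y. g y [\<Gamma> y v z, w]) has_derivative
     (\<lambda>h. frechet_derivative (\<lambda>y. g y [\<Gamma> x v z, w]) (at x) h
        + g x [frechet_derivative (\<lambda>y. \<Gamma> y v z) (at x) h, w])) (at x)"
    by (rule has_derivative_linear_slot[OF open_U assms g_linear g_diff[OF assms] \<Gamma>_diff[OF assms]])
  moreover have "(\<lambda>y. g y [\<Gamma> y v z, w]) = lowered v z w"
    by (simp add: fun_eq_iff lowered_def)
  moreover have "lowered h w (\<Gamma> x v z) x = g x [\<Gamma> x v z, \<Gamma> x h w]" for h
    unfolding lowered_def by (rule g_sym[OF assms])
  ultimately show ?thesis by (simp add: g_deriv[OF assms])
qed

lemma dlowered_eq:
  assumes "x \<in> U"
  shows "dlowered x u v z w = lowered u (\<Gamma> x v z) w x + g x [\<Gamma> x v z, \<Gamma> x u w]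
        + g x [frechet_derivative (\<lambda>y. \<Gamma> y v z) (at x) u, w]"
  by (simp add: dlowered_def frechet_derivative_at[OF lowered_has_derivative[OF assms], symmetric])

lemma lowered_differentiable: "x \<in> U \<Longrightarrow> lowered u v w differentiable at x"
  using lowered_has_derivative differentiable_def by blast

text \<open>The locale grants one derivative of \<open>g\<close>. A second one exists because
  metricity writes the first through the differentiable functions \<open>lowered\<close>.\<close>

lemma g_deriv_has_derivative:
  assumes "x \<in> U"
  shows "((\<lambda>y. frechet_derivative (\<lambda>y. g y [z, w]) (at y) v) has_derivative
      (\<lambda>u. dlowered x u v z w + dlowered x u v w z)) (at x)"
proof -
  have "((\<lambda>y. lowered v z w y + lowered v w z y) has_derivative
      (\<lambda>u. dlowered x u v z w + dlowered x u v w z)) (at x)"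
    unfolding dlowered_def using lowered_differentiable[OF assms] frechet_derivative_works
    by (intro has_derivative_add) blast+
  then show ?thesis
    by (rule has_derivative_transform_within_open[OF _ open_U assms]) (simp add: g_deriv)
qed

text \<open>The two sides are the mixed second derivatives of \<open>g [z, w]\<close>.\<close>

lemma dlowered_symmetric:
  assumes "x \<in> U"
  shows "dlowered x u v z w + dlowered x u v w z = dlowered x v u z w + dlowered x v u w z"
proof -
  have *: "frechet_derivative (\<lambda>y. frechet_derivative (\<lambda>y. g y [z, w]) (at y) v) (at x) u =
        dlowered x u v z w + dlowered x u v w z" for u v
    by (simp add: frechet_derivative_at[OF g_deriv_has_derivative[OF assms], symmetric])
  have "frechet_derivative (\<lambda>y. frechet_derivative (\<lambda>y. g y [z, w]) (at y) v) (at x) u =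
    frechet_derivative (\<lambda>y. frechet_derivative (\<lambda>y. g y [z, w]) (at y) u) (at x) v"
    by (rule second_derivative_symmetric[OF open_U assms g_diff])
       (use g_deriv_has_derivative[OF assms] differentiable_def in blast)+
  then show ?thesis by (simp add: *)
qed

text \<open>Passing from derivatives of \<open>\<Gamma>\<close> to derivatives of
  \<open>lowered\<close> absorbs the iterated terms such as
  \<open>\<Gamma> x u (\<Gamma> x v z)\<close> and leaves inner products of two Christoffel symbols.
  In this form the quadratic terms of two curvatures can be compared.\<close>

lemma curvature_lowered:
  assumes "x \<in> U"
  shows "curvature_tensor g \<Gamma> x u v z w = dlowered x u v z w - dlowered x v u z w
     - g x [\<Gamma> x v z, \<Gamma> x u w] + g x [\<Gamma> x u z, \<Gamma> x v w]"
  by (simp add: curvature_tensor_def curvature_const[of \<Gamma> x, OF \<Gamma>_bilinear[OF assms]] curvature_const_def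
      dlowered_eq[OF assms] lowered_def linear_add[OF g_linear[OF assms]] linear_diff[OF g_linear[OF assms]])

lemma curvature_skew: "x \<in> U \<Longrightarrow> curvature_tensor g \<Gamma> x u v z w = - curvature_tensor g \<Gamma> x u v w z"
  using dlowered_symmetric[of x u v z w] by (simp add: curvature_lowered g_sym)

text \<open>The Ricci identity for a parallel form. The equation of parallelism is differentiated
  once more and antisymmetrised in \<open>u\<close> and \<open>v\<close>: terms that act on two
  different arguments cancel, and those that act twice on one argument combine to the
  curvature.\<close>

lemma curvature_derivation:
  assumes x: "x \<in> U" and ml: "\<And>y. y \<in> U \<Longrightarrow> multilinear 3 (\<phi> y)"
    and sm: "\<And>vs. length vs = 3 \<Longrightarrow> smooth_on U (\<lambda>y. \<phi> y vs)"
    and par: "\<And>y u vs. y \<in> U \<Longrightarrow> length vs = 3 \<Longrightarrow> cov_deriv_tensor \<Gamma> \<phi> y u vs = 0"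
  shows "\<phi> x [curvature \<Gamma> (\<lambda>_. u) (\<lambda>_. v) (\<lambda>_. a) x, b, c] + \<phi> x [a, curvature \<Gamma> (\<lambda>_. u) (\<lambda>_. v) (\<lambda>_. b) x, c]
     + \<phi> x [a, b, curvature \<Gamma> (\<lambda>_. u) (\<lambda>_. v) (\<lambda>_. c) x] = 0"
proof -
  have l: "linear (\<lambda>a. \<phi> y [a, b, c])" "linear (\<lambda>b. \<phi> y [a, b, c])" "linear (\<lambda>c. \<phi> y [a, b, c])"
    if "y \<in> U" for y a b c
    using multilinear_slot[OF ml[OF that], of "[a, b, c]" 0] multilinear_slot[OF ml[OF that], of "[a, b, c]" 1]
      multilinear_slot[OF ml[OF that], of "[a, b, c]" 2] by (simp_all add: numeral_2_eq_2)
  have d: "(\<lambda>y. \<phi> y [a, b, c]) differentiable at y" if "y \<in> U" for y a b c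
    using smooth_on_differentiable[OF sm that] by simp
  have P: "frechet_derivative (\<lambda>y. \<phi> y [a, b, c]) (at y) u
     = \<phi> y [\<Gamma> y u a, b, c] + \<phi> y [a, \<Gamma> y u b, c] + \<phi> y [a, b, \<Gamma> y u c]" if "y \<in> U" for y u a b c
    using par[OF that, of "[a, b, c]" u] by (simp add: cov_deriv_tensor_def cov_deriv_const lessThan_Suc numeral_3_eq_3)
  define d\<Gamma> where "d\<Gamma> v a u = frechet_derivative (\<lambda>y. \<Gamma> y v a) (at x) u" for v a u
  have "((\<lambda>y. \<phi> y [\<Gamma> y v a, b, c] + \<phi> y [a, \<Gamma> y v b, c] + \<phi> y [a, b, \<Gamma> y v c]) has_derivative
     (\<lambda>u. (frechet_derivative (\<lambda>y. \<phi> y [\<Gamma> x v a, b, c]) (at x) u + \<phi> x [d\<Gamma> v a u, b, c])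
       + (frechet_derivative (\<lambda>y. \<phi> y [a, \<Gamma> x v b, c]) (at x) u + \<phi> x [a, d\<Gamma> v b u, c])
       + (frechet_derivative (\<lambda>y. \<phi> y [a, b, \<Gamma> x v c]) (at x) u + \<phi> x [a, b, d\<Gamma> v c u]))) (at x)" for v
    unfolding d\<Gamma>_def
    using has_derivative_linear_slot[OF open_U x l(1) d[OF x] \<Gamma>_diff[OF x]]
      has_derivative_linear_slot[OF open_U x l(2) d[OF x] \<Gamma>_diff[OF x]]
      has_derivative_linear_slot[OF open_U x l(3) d[OF x] \<Gamma>_diff[OF x]]
    by (intro has_derivative_add)
  then have "((\<lambda>y. frechet_derivative (\<lambda>y. \<phi> y [a, b, c]) (at y) v) has_derivative
     (\<lambda>u. (frechet_derivative (\<lambda>y. \<phi> y [\<Gamma> x v a, b, c]) (at x) u + \<phi> x [d\<Gamma> v a u, b, c])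
       + (frechet_derivative (\<lambda>y. \<phi> y [a, \<Gamma> x v b, c]) (at x) u + \<phi> x [a, d\<Gamma> v b u, c])
       + (frechet_derivative (\<lambda>y. \<phi> y [a, b, \<Gamma> x v c]) (at x) u + \<phi> x [a, b, d\<Gamma> v c u]))) (at x)" for v
    by (rule has_derivative_transform_within_open[OF _ open_U x]) (simp add: P)
  note S = frechet_derivative_at[OF this, symmetric]
  have "frechet_derivative (\<lambda>y. frechet_derivative (\<lambda>y. \<phi> y [a, b, c]) (at y) v) (at x) u =
     frechet_derivative (\<lambda>y. frechet_derivative (\<lambda>y. \<phi> y [a, b, c]) (at y) u) (at x) v"
    by (rule second_derivative_symmetric[OF open_U x d])
       (auto intro!: smooth_on_differentiable[OF smooth_on_frechet_derivative[OF sm] x])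
  then show ?thesis
    by (simp add: S P[OF x] curvature_const[of \<Gamma> x, OF \<Gamma>_bilinear[OF x]] curvature_const_def d\<Gamma>_def
        linear_add[OF l(1)[OF x]] linear_add[OF l(2)[OF x]] linear_add[OF l(3)[OF x]]
        linear_diff[OF l(1)[OF x]] linear_diff[OF l(2)[OF x]] linear_diff[OF l(3)[OF x]])
qed

end

section \<open>Comparison of the two connections and of their curvatures\<close>

text \<open>Exchanging the lower arguments of \<open>\<Gamma>\<close> reverses the torsion, and
  skewness of \<open>T\<close> keeps the result compatible with \<open>g\<close>. Uniqueness is the
  argument known from the Levi-Civita connection, applied to the difference
  \<open>D\<close>.\<close>

lemma metric_connection_transpose:
  assumes "chart_metric_connection U g \<Gamma>" "chart_metric_connection U g \<Gamma>h" and y: "y \<in> U"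
    and T: "\<And>u v w. torsion_tensor g \<Gamma> y [u, v, w] = T u v w"
    and Th: "\<And>u v w. torsion_tensor g \<Gamma>h y [u, v, w] = - T u v w"
    and skew: "\<And>u v w. T u w v = - T u v w"
  shows "\<Gamma>h y u v = \<Gamma> y v u"
proof -
  interpret G: chart_metric_connection U g \<Gamma> by fact
  interpret H: chart_metric_connection U g \<Gamma>h by fact
  have GT: "G.lowered u v w y - G.lowered v u w y = T u v w" for u v w
    using T[of u v w] by (simp add: torsion_tensor_def torsion_def cov_deriv_const lie_bracket_const
        G.lowered_def linear_diff[OF G.g_linear[OF y]])
  have HT: "H.lowered u v w y - H.lowered v u w y = - T u v w" for u v w
    using Th[of u v w] by (simp add: torsion_tensor_def torsion_def cov_deriv_const lie_bracket_const
        H.lowered_def linear_diff[OF G.g_linear[OF y]])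
  have gd: "G.lowered u v w y + G.lowered u w v y = H.lowered u v w y + H.lowered u w v y" for u v w
    using G.g_deriv[OF y, of v w u] H.g_deriv[OF y, of v w u] by simp
  \<comment> \<open>The difference is symmetric in its first two and skew in its last two arguments.\<close>
  define D where "D u v w = H.lowered u v w y - G.lowered v u w y" for u v w
  have "D u v w = D v u w" for u v w
    using GT[of u v w] HT[of u v w] by (simp add: D_def)
  moreover have "D u v w = - D u w v" for u v w
    using GT[of u v w] GT[of u w v] gd[of u v w] skew[of u v w] by (simp add: D_def)
  \<comment> \<open>Alternating the two symmetries gives \<open>D u v w = - D u w v = - D w u v = D
    w v u = D v w u = - D v u w = - D u v w\<close>.\<close>
  ultimately have "D u v w = 0" for w
    by (smt (verit))
  then have "g y [\<Gamma>h y u v - \<Gamma> y v u, w] = 0" for w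
    by (simp add: D_def G.lowered_def H.lowered_def linear_diff[OF G.g_linear[OF y]])
  then show ?thesis using G.g_pos[OF y] by (metis eq_iff_diff_eq_0)
qed

text \<open>Polarisation, with \<open>u + v\<close> or \<open>v + w\<close> in two adjacent
  places.\<close>

lemma alternating_3_swap:
  assumes m: "multilinear 3 \<alpha>" and a: "alternating 3 \<alpha>"
  shows "\<alpha> [v, u, w] = - \<alpha> [u, v, w]" "\<alpha> [u, w, v] = - \<alpha> [u, v, w]"
proof -
  have l: "linear (\<lambda>a. \<alpha> [a, b, c])" "linear (\<lambda>b. \<alpha> [a, b, c])" "linear (\<lambda>c. \<alpha> [a, b, c])" for a b c
    using multilinear_slot[OF m, of "[a, b, c]" 0] multilinear_slot[OF m, of "[a, b, c]" 1]
      multilinear_slot[OF m, of "[a, b, c]" 2] by (simp_all add: numeral_2_eq_2)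
  have z: "\<alpha> [a, a, c] = 0" "\<alpha> [c, a, a] = 0" for a c
    using a[unfolded alternating_def, rule_format, of "[a, a, c]" 0 1]
      a[unfolded alternating_def, rule_format, of "[c, a, a]" 1 2] by simp_all
  show "\<alpha> [v, u, w] = - \<alpha> [u, v, w]"
    using z(1)[of "u + v" w] z(1)[of u w] z(1)[of v w] by (simp add: linear_add[OF l(1)] linear_add[OF l(2)])
  show "\<alpha> [u, w, v] = - \<alpha> [u, v, w]"
    using z(2)[of u "v + w"] z(2)[of u v] z(2)[of u w] by (simp add: linear_add[OF l(3)] linear_add[OF l(2)])
qed

lemma ext_deriv_3:
  "ext_deriv \<alpha> x [a, b, c, d] =
     frechet_derivative (\<lambda>y. \<alpha> y [b, c, d]) (at x) a - frechet_derivative (\<lambda>y. \<alpha> y [a, c, d]) (at x) b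
   + frechet_derivative (\<lambda>y. \<alpha> y [a, b, d]) (at x) c - frechet_derivative (\<lambda>y. \<alpha> y [a, b, c]) (at x) d"
  by (simp add: ext_deriv_def lessThan_Suc eval_nat_numeral)

lemma frechet_derivative_minus_eq:
  fixes f :: "'a::real_normed_vector \<Rightarrow> real"
  assumes "open U" "x \<in> U" "\<And>y. y \<in> U \<Longrightarrow> h y = - f y" "f differentiable at x"
  shows "frechet_derivative h (at x) u = - frechet_derivative f (at x) u"
proof -
  have f: "(f has_derivative frechet_derivative f (at x)) (at x)"
    using assms(4) frechet_derivative_works by blast
  have "(h has_derivative (\<lambda>u. - frechet_derivative f (at x) u)) (at x)"
    by (rule has_derivative_transform_within_open[OF has_derivative_minus[OF f] assms(1,2)]) (simp add: assms(3))
  from frechet_derivative_at[OF this, symmetric] show ?thesis by simp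
qed

lemma frechet_derivative_form_swap:
  assumes U: "open U" "x \<in> U"
    and form: "\<And>y. y \<in> U \<Longrightarrow> multilinear 3 (T y)" "\<And>y. y \<in> U \<Longrightarrow> alternating 3 (T y)"
    and d: "\<And>u v w. (\<lambda>y. T y [u, v, w]) differentiable at x"
  shows "frechet_derivative (\<lambda>y. T y [v, u, w]) (at x) a = - frechet_derivative (\<lambda>y. T y [u, v, w]) (at x) a"
    "frechet_derivative (\<lambda>y. T y [u, w, v]) (at x) a = - frechet_derivative (\<lambda>y. T y [u, v, w]) (at x) a"
  by (rule frechet_derivative_minus_eq[OF U alternating_3_swap(1)[OF form] d], assumption+)
     (rule frechet_derivative_minus_eq[OF U alternating_3_swap(2)[OF form] d], assumption+)

text \<open>The argument pairs are exchanged to make the quadratic terms agree: since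
  \<open>\<Gamma>h x w u\<close> is \<open>\<Gamma> x u w\<close>, both curvatures contain the same
  inner products of Christoffel symbols. The remainder is linear in the derivatives
  \<open>dlowered\<close>.\<close>

lemma curvature_pair_difference:
  assumes "chart_metric_connection U g \<Gamma>" "chart_metric_connection U g \<Gamma>h" and x: "x \<in> U"
    and T: "\<And>y u v w. y \<in> U \<Longrightarrow> torsion_tensor g \<Gamma> y [u, v, w] = T y [u, v, w]"
    and Th: "\<And>y u v w. y \<in> U \<Longrightarrow> torsion_tensor g \<Gamma>h y [u, v, w] = - T y [u, v, w]"
    and form: "\<And>y. y \<in> U \<Longrightarrow> multilinear 3 (T y)" "\<And>y. y \<in> U \<Longrightarrow> alternating 3 (T y)"
    and Td: "\<And>u v w. (\<lambda>y. T y [u, v, w]) differentiable at x"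
  shows "ext_deriv T x [u, v, z, w] =
    2 * (curvature_tensor g \<Gamma> x u v z w - curvature_tensor g \<Gamma>h x z w u v)"
proof -
  interpret G: chart_metric_connection U g \<Gamma> by fact
  interpret H: chart_metric_connection U g \<Gamma>h by fact
  note swap = alternating_3_swap[OF form]
  have tr: "\<Gamma>h y u v = \<Gamma> y v u" if "y \<in> U" for y u v
    using metric_connection_transpose[OF assms(1,2) that T[OF that] Th[OF that] swap(2)[OF that that]] .
  define DT where "DT a b c d = frechet_derivative (\<lambda>y. T y [b, c, d]) (at x) a" for a b c d
  have DT1: "DT a c b d = - DT a b c d" and DT2: "DT a b d c = - DT a b c d" for a b c d
    unfolding DT_def
    by (rule frechet_derivative_form_swap(1)[OF G.open_U x form Td], assumption+)
       (rule frechet_derivative_form_swap(2)[OF G.open_U x form Td], assumption+)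
  have GT: "G.lowered u v w y - G.lowered v u w y = T y [u, v, w]" if y: "y \<in> U" for u v w y
    using T[OF y, of u v w] by (simp add: torsion_tensor_def torsion_def cov_deriv_const lie_bracket_const
        G.lowered_def linear_diff[OF G.g_linear[OF y]])
  have dGT: "G.dlowered x a b c d - G.dlowered x a c b d = DT a b c d" for a b c d
  proof -
    have "((\<lambda>y. G.lowered b c d y - G.lowered c b d y) has_derivative
        (\<lambda>a. G.dlowered x a b c d - G.dlowered x a c b d)) (at x)"
      unfolding G.dlowered_def using G.lowered_differentiable[OF x] frechet_derivative_works
      by (intro has_derivative_diff) blast+
    then have "((\<lambda>y. T y [b, c, d]) has_derivative
        (\<lambda>a. G.dlowered x a b c d - G.dlowered x a c b d)) (at x)"
      by (rule has_derivative_transform_within_open[OF _ G.open_U x]) (simp add: GT)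
    from frechet_derivative_at[OF this, symmetric] show ?thesis by (simp add: DT_def)
  qed
  have "H.lowered b c d y = G.lowered c b d y" if "y \<in> U" for b c d y
    by (simp add: H.lowered_def G.lowered_def tr[OF that])
  then have dH: "H.dlowered x a b c d = G.dlowered x a c b d" for a b c d
    unfolding H.dlowered_def G.dlowered_def
    by (intro fun_cong[OF frechet_derivative_cong_open[OF G.open_U x]])
  \<comment> \<open>A cyclic permutation of the three arguments of the form is a product of two
    transpositions.\<close>
  have cyc: "DT a c d b = DT a b c d" "DT a d b c = DT a b c d" for a b c d
    using DT2[of a c b d] DT1[of a b c d] DT1[of a b d c] DT2[of a b c d] by linarith+
  define S where "S a b c d = G.dlowered x a b c d + G.dlowered x a b d c" for a b c d
  have S: "S a b c d = S b a c d" "S a b c d = S a b d c" for a b c d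
    using G.dlowered_symmetric[OF x, of a b c d] by (simp_all add: S_def)
  \<comment> \<open>The differentiated Koszul formula; \<open>S a b c d\<close> is the second derivative of \<open>g [c, d]\<close>.\<close>
  have koszul: "2 * G.dlowered x a b c d = S a b c d + S a c b d - S a d b c + DT a b c d" for a b c d
    using dGT[of a b c d] dGT[of a c d b] dGT[of a d b c] cyc[of a b c d] unfolding S_def by linarith
  have "curvature_tensor g \<Gamma> x u v z w - curvature_tensor g \<Gamma>h x z w u v =
      G.dlowered x u v z w - G.dlowered x v u z w - G.dlowered x z u w v + G.dlowered x w u z v"
    by (simp add: G.curvature_lowered[OF x] H.curvature_lowered[OF x] dH tr[OF x] G.g_sym[OF x])
  moreover have "ext_deriv T x [u, v, z, w] = DT u v z w - DT v u z w + DT z u v w - DT w u v z"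
    by (simp add: ext_deriv_3 DT_def)
  \<comment> \<open>In the four Koszul formulas the twelve \<open>S\<close> terms cancel in six
    pairs, by the symmetry of second derivatives and of \<open>g\<close>. The four \<open>DT\<close>
    terms make up the exterior derivative.\<close>
  moreover have "2 * (G.dlowered x u v z w - G.dlowered x v u z w - G.dlowered x z u w v + G.dlowered x w u z v) =
      DT u v z w - DT v u z w + DT z u v w - DT w u v z"
    using koszul[of u v z w] koszul[of v u z w] koszul[of z u w v] koszul[of w u z v]
      S(1)[of u v z w] S(1)[of u z v w] S(1)[of u w v z] S(1)[of v z u w] S(1)[of v w u z] S(1)[of z w u v]
      S(2)[of z u w v] S(2)[of w u z v] DT2[of z u v w] DT2[of w u v z]
    by (simp add: algebra_simps)
  ultimately show ?thesis by simp
qed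

section \<open>Linear algebra of the standard \<open>G\<^sub>2\<close> form\<close>

lemma covector_wedge_3:
  "covector_wedge [a, b, c] [u, v, w] =
     a u * (b v * c w - b w * c v) - a v * (b u * c w - b w * c u) + a w * (b u * c v - b v * c u)"
proof -
  have s: "{..<length [a, b, c]} = insert 0 (insert 1 {2::nat})" by auto
  have f: "finite {1::nat, 2}" "0 \<notin> {1::nat, 2}" "finite {2::nat}" "1 \<notin> {2::nat}" by auto
  show ?thesis
    unfolding covector_wedge_def s sum_over_permutations_insert[OF f(1,2)]
      sum_over_permutations_insert[OF f(3,4)] permutes_sing
    by (simp add: sign_swap_id permutation_swap_id sign_compose sign_id swap_id_eq)
      (simp add: transpose_def algebra_simps)
qed

lemma UNIV_7: "(UNIV::7 set) = {1,2,3,4,5,6,7}"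
  by (rule sym, rule card_subset_eq) simp_all

lemma forall_7: "(\<forall>i::7. P i) \<longleftrightarrow> P 1 \<and> P 2 \<and> P 3 \<and>
  P 4 \<and> P 5 \<and> P 6 \<and> P 7"
  using UNIV_7 by (metis (full_types) UNIV_I empty_iff insert_iff)

section \<open>Vanishing of a 4-form whose contractions vanish\<close>

text \<open>For fixed \<open>i\<close> and \<open>j\<close> the seven equations express that the
  contraction of the 2-form \<open>s i j\<close> with the standard form vanishes. Of the 35
  four-element index sets, 28 consist of a line of the Fano plane and one further point, and 7 are
  complements of lines, so \<open>A\<close> and \<open>B\<close> cover them all.\<close>

lemma skew4_eq_0:
  fixes s :: "7 \<Rightarrow> 7 \<Rightarrow> 7 \<Rightarrow> 7 \<Rightarrow> real"
  assumes s12: "\<And>i j k l. s i j k l = - s j i k l"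
    and s23: "\<And>i j k l. s i j k l = - s i k j l"
    and s34: "\<And>i j k l. s i j k l = - s i j l k"
    and 1: "\<And>i j. s i j 2 7 + s i j 3 5 - s i j 4 6 = 0"
    and 2: "\<And>i j. s i j 1 7 + s i j 3 6 + s i j 4 5 = 0"
    and 3: "\<And>i j. s i j 1 5 - s i j 2 6 - s i j 4 7 = 0"
    and 4: "\<And>i j. s i j 1 6 + s i j 2 5 - s i j 3 7 = 0"
    and 5: "\<And>i j. s i j 1 3 - s i j 2 4 + s i j 6 7 = 0"
    and 6: "\<And>i j. s i j 1 4 + s i j 2 3 + s i j 5 7 = 0"
    and 7: "\<And>i j. s i j 1 2 + s i j 3 4 + s i j 5 6 = 0"
  shows "s i j k l = 0"
proof -
  have rep1: "s i i k l = 0" "s i j j l = 0" "s i j k k = 0" for i j k l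
    using s12[of i i k l] s23[of i j j l] s34[of i j k k] by auto
  have rep2: "s i j i l = 0" "s i j k j = 0" for i j k l
    by (simp_all add: s23[of i j i l] s34[of i j k j] rep1)
  have rep3: "s i j k i = 0" for i j k
    by (simp add: s34[of i j k i] rep2)
  note rep = rep1 rep2 rep3
  \<comment> \<open>A term of the standard form is a line of the Fano plane. \<open>A\<close> lists the index sets that contain a
    line: if \<open>i\<close> and \<open>j\<close> lie in two different pairs of an equation, only its third term survives.
    \<open>B\<close> lists the complements of lines, where \<open>i\<close> and \<open>j\<close> form one of the pairs.\<close>
  have A: "s 1 3 5 6 = 0 \<and> s 1 4 5 6 = 0 \<and> s 2 3 5 6 = 0 \<and> s 2 4 5 6 = 0 \<and>
    s 1 5 3 4 = 0 \<and> s 1 6 3 4 = 0 \<and> s 2 5 3 4 = 0 \<and> s 2 6 3 4 = 0 \<and>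
    s 3 5 1 2 = 0 \<and> s 3 6 1 2 = 0 \<and> s 4 5 1 2 = 0 \<and> s 4 6 1 2 = 0 \<and>
    s 7 3 4 6 = 0 \<and> s 7 5 4 6 = 0 \<and> s 7 4 3 5 = 0 \<and> s 7 6 3 5 = 0 \<and>
    s 3 4 2 7 = 0 \<and> s 3 6 2 7 = 0 \<and> s 5 4 2 7 = 0 \<and> s 5 6 2 7 = 0 \<and>
    s 3 4 1 7 = 0 \<and> s 3 5 1 7 = 0 \<and> s 6 4 1 7 = 0 \<and> s 6 5 1 7 = 0 \<and>
    s 1 2 4 7 = 0 \<and> s 1 7 2 6 = 0 \<and> s 2 7 1 5 = 0 \<and> s 1 2 3 7 = 0"
    using 7[of 1 3] 7[of 1 4] 7[of 2 3] 7[of 2 4] 7[of 1 5] 7[of 1 6] 7[of 2 5] 7[of 2 6]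
      7[of 3 5] 7[of 3 6] 7[of 4 5] 7[of 4 6] 1[of 7 3] 1[of 7 5] 1[of 7 4] 1[of 7 6] 1[of 3 4]
      1[of 3 6] 1[of 5 4] 1[of 5 6] 2[of 3 4] 2[of 3 5] 2[of 6 4] 2[of 6 5] 3[of 1 2] 3[of 1 7]
      3[of 2 7] 4[of 1 2] by (simp add: rep)
  \<comment> \<open>Exchanging the two index pairs is an even permutation; it identifies unknowns of
    different equations in \<open>B\<close>.\<close>
  have flip: "s k l i j = s i j k l" for i j k l
    using s12[of k i l j] s23[of k l i j] s34[of i k l j] s23[of i k j l] by simp
  \<comment> \<open>For an equation with pairs \<open>P\<close>, \<open>Q\<close>, \<open>R\<close>,
    taking each pair in turn as \<open>i j\<close> yields three relations among the three values
    \<open>s P Q\<close>, \<open>s P R\<close>, \<open>s Q R\<close>. Their determinant is 2 or -2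
    whatever the signs, so the values vanish.\<close>
  have B: "s 2 7 3 5 = 0 \<and> s 2 7 4 6 = 0 \<and> s 3 5 4 6 = 0 \<and> s 1 7 3 6 = 0 \<and>
    s 1 7 4 5 = 0 \<and> s 3 6 4 5 = 0 \<and> s 1 5 2 6 = 0 \<and> s 1 5 4 7 = 0 \<and>
    s 2 6 4 7 = 0 \<and> s 1 6 2 5 = 0 \<and> s 1 6 3 7 = 0 \<and> s 2 5 3 7 = 0 \<and>
    s 1 3 2 4 = 0 \<and> s 1 3 6 7 = 0 \<and> s 2 4 6 7 = 0 \<and> s 1 4 2 3 = 0 \<and>
    s 1 4 5 7 = 0 \<and> s 2 3 5 7 = 0 \<and> s 1 2 3 4 = 0 \<and> s 1 2 5 6 = 0 \<and>
    s 3 4 5 6 = 0"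
    using 1[of 2 7] 1[of 3 5] 1[of 4 6] 2[of 1 7] 2[of 3 6] 2[of 4 5] 3[of 1 5] 3[of 2 6]
      3[of 4 7] 4[of 1 6] 4[of 2 5] 4[of 3 7] 5[of 1 3] 5[of 2 4] 5[of 6 7] 6[of 1 4] 6[of 2 3]
      6[of 5 7] 7[of 1 2] 7[of 3 4] 7[of 5 6]
    by (simp add: rep) (simp add: flip)
  have perm: "s i j k l = 0 \<longleftrightarrow> s j i k l = 0" "s i j k l = 0 \<longleftrightarrow> s i k j l = 0"
    "s i j k l = 0 \<longleftrightarrow> s i j l k = 0" for i j k l
    using s12[of i j k l] s23[of i j k l] s34[of i j k l] by auto
  \<comment> \<open>\<open>Q\<close> treats all seven values of the last index at once. The 35
    increasing triples are checked; every other triple reduces to one of them by transpositions or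
    has a repeated index.\<close>
  define Q where "Q i j k \<longleftrightarrow> (\<forall>l. s i j k l = 0)" for i j k
  have "Q 1 2 3 \<and> Q 1 2 4 \<and> Q 1 2 5 \<and> Q 1 2 6 \<and> Q 1 2 7 \<and> Q 1 3 4 \<and>
    Q 1 3 5 \<and> Q 1 3 6 \<and> Q 1 3 7 \<and> Q 1 4 5 \<and> Q 1 4 6 \<and> Q 1 4 7 \<and>
    Q 1 5 6 \<and> Q 1 5 7 \<and> Q 1 6 7 \<and> Q 2 3 4 \<and> Q 2 3 5 \<and> Q 2 3 6 \<and>
    Q 2 3 7 \<and> Q 2 4 5 \<and> Q 2 4 6 \<and> Q 2 4 7 \<and> Q 2 5 6 \<and> Q 2 5 7 \<and>
    Q 2 6 7 \<and> Q 3 4 5 \<and> Q 3 4 6 \<and> Q 3 4 7 \<and> Q 3 5 6 \<and> Q 3 5 7 \<and>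
    Q 3 6 7 \<and> Q 4 5 6 \<and> Q 4 5 7 \<and> Q 4 6 7 \<and> Q 5 6 7"
    unfolding Q_def forall_7 using A B by (simp add: perm rep)
  moreover have "Q i j k \<longleftrightarrow> Q j i k" "Q i j k \<longleftrightarrow> Q i k j"
    "Q i i k" "Q i k k" for i j k
    unfolding Q_def using perm rep by auto
  ultimately have "\<forall>i j k. Q i j k"
    unfolding forall_7 by simp
  then show ?thesis by (simp add: Q_def)
qed

section \<open>Dual frames and contractions with the standard form\<close>

definition dual_frame :: "(7 \<Rightarrow> coord7 \<Rightarrow> real) \<Rightarrow> (7 \<Rightarrow> coord7) \<Rightarrow> bool" where
  "dual_frame e f \<longleftrightarrow> (\<forall>i. linear (e i)) \<and> (\<forall>i j. e i (f j) = (if i = j then 1 else 0)) \<and>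
     (\<forall>v. (\<Sum>i\<in>UNIV. e i v *\<^sub>R f i) = v)"

text \<open>Regarded as a linear map \<open>E\<close> to \<open>real ^ 7\<close>, a coframe is
  injective, hence surjective; the frame consists of preimages of the standard basis. The expansion
  of \<open>v\<close> holds because both sides have the same components.\<close>

lemma coframe_has_dual_frame:
  assumes "coframe e"
  shows "\<exists>f. dual_frame e f"
proof -
  have lin: "linear (e i)" and inj: "(\<And>i. e i v = 0) \<Longrightarrow> v = 0" for i v
    using assms by (auto simp: coframe_def)
  define E :: "coord7 \<Rightarrow> coord7" where "E v = (\<chi> i. e i v)" for v
  have E: "linear E"
    by (rule linearI) (simp_all add: E_def vec_eq_iff linear_add[OF lin] linear_scale[OF lin])
  have "inj E"
  proof (unfold linear_injective_0[OF E], intro allI impI)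
    fix v assume "E v = 0"
    then have "e i v = 0" for i by (metis E_def vec_lambda_beta zero_index)
    then show "v = 0" by (rule inj)
  qed
  then have "surj E" by (rule linear_inj_imp_surj[OF E])
  then have "\<forall>j. \<exists>v. E v = axis j 1" by (metis surjD)
  then obtain f where f: "\<And>j. E (f j) = axis j 1" by metis
  have ef: "e i (f j) = (if i = j then 1 else 0)" for i j
    using f[of j] by (auto simp: E_def vec_eq_iff axis_def)
  have "(\<Sum>i\<in>UNIV. e i v *\<^sub>R f i) - v = 0" for v
    by (rule inj) (simp add: linear_diff[OF lin] linear_sum[OF lin] linear_scale[OF lin] ef if_distrib[of "\<lambda>x. _ * x"] cong: if_cong)
  then have "dual_frame e f" using lin ef by (simp add: dual_frame_def)
  then show ?thesis by blast
qed

lemma linear_eq_0_on_frame: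
  assumes "dual_frame e f" "linear L" "\<And>i. L (f i) = (0::real)"
  shows "L v = 0"
proof -
  have "L (\<Sum>i\<in>UNIV. e i v *\<^sub>R f i) = 0"
    using assms(3) by (simp add: linear_sum[OF assms(2)] linear_scale[OF assms(2)])
  then show ?thesis using assms(1) by (simp add: dual_frame_def)
qed

text \<open>The transition matrix \<open>Q\<close> between \<open>h\<close> and \<open>f\<close> is
  orthogonal. This carries results computed in a frame dual to an adapted coframe over to every
  orthonormal frame.\<close>

lemma orthonormal_frame_contraction:
  assumes f: "dual_frame e f" and g: "\<And>u v. g [u, v] = (\<Sum>i\<in>UNIV. e i u * e i v)"
    and h: "orthonormal_frame g h" and B: "linear B" and C: "linear (C :: coord7 \<Rightarrow> real)"
  shows "(\<Sum>a\<in>UNIV. B (h a) * C (h a)) = (\<Sum>i\<in>UNIV. B (f i) * (C (f i) :: real))"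
proof -
  define Q where "Q = (\<chi> a i. e i (h a))"
  have "Q ** transpose Q = mat 1"
    using h by (simp add: orthonormal_frame_def g Q_def matrix_matrix_mult_def transpose_def vec_eq_iff mat_def)
  \<comment> \<open>Orthonormality of \<open>h\<close> concerns the rows of \<open>Q\<close>, the
    change of frame its columns; for a square matrix a right inverse is also a left inverse.\<close>
  then have "transpose Q ** Q = mat 1"
    by (simp add: matrix_left_right_inverse)
  then have Q: "(\<Sum>a\<in>UNIV. e i (h a) * e j (h a)) = (if i = j then 1 else 0)" for i j
    by (simp add: Q_def matrix_matrix_mult_def transpose_def vec_eq_iff mat_def)
  have expand: "L v = (\<Sum>i\<in>UNIV. e i v * L (f i))" if "linear L" for L :: "coord7 \<Rightarrow> real" and v
  proof -
    have "L (\<Sum>i\<in>UNIV. e i v *\<^sub>R f i) = (\<Sum>i\<in>UNIV. e i v * L (f i))"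
      by (simp add: linear_sum[OF that] linear_scale[OF that])
    then show ?thesis using f by (simp add: dual_frame_def)
  qed
  have "(\<Sum>a\<in>UNIV. B (h a) * C (h a)) =
      (\<Sum>a\<in>UNIV. \<Sum>i\<in>UNIV. \<Sum>j\<in>UNIV. (e i (h a) * e j (h a)) * (B (f i) * C (f j)))"
    by (subst expand[OF B], subst expand[OF C]) (simp add: sum_product ac_simps)
  also have "\<dots> = (\<Sum>i\<in>UNIV. \<Sum>j\<in>UNIV. (\<Sum>a\<in>UNIV. e i (h a) * e j (h a)) * (B (f i) * C (f j)))"
    unfolding sum_distrib_right
    by (subst sum.swap, rule sum.cong[OF refl], rule sum.swap)
  also have "\<dots> = (\<Sum>i\<in>UNIV. B (f i) * C (f i))"
    by (simp add: Q if_distrib[of "\<lambda>x. x * _"] cong: if_cong)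
  finally show ?thesis .
qed

lemma covector_wedge_contraction:
  assumes "dual_frame e f"
  shows "(\<Sum>a\<in>UNIV. \<Sum>b\<in>UNIV. r a b * covector_wedge [e p, e q, e s] [f a, f b, w]) =
     (r p q - r q p) * e s w + (r q s - r s q) * e p w + (r s p - r p s) * e q w"
proof -
  have ef: "e i (f j) = (if i = j then 1 else 0)" for i j
    using assms by (simp add: dual_frame_def)
  have D: "(\<Sum>a\<in>UNIV. \<Sum>b\<in>UNIV. r a b * (e i (f a) * e j (f b))) = r i j" for i j
    by (simp add: ef if_distrib[of "\<lambda>x. _ * x"] if_distrib[of "\<lambda>x. x * _"] cong: if_cong)
  have "(\<Sum>a\<in>UNIV. \<Sum>b\<in>UNIV. r a b * covector_wedge [e p, e q, e s] [f a, f b, w]) =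
     (\<Sum>a\<in>UNIV. \<Sum>b\<in>UNIV.
        e s w * (r a b * (e p (f a) * e q (f b))) - e s w * (r a b * (e q (f a) * e p (f b)))
      + e p w * (r a b * (e q (f a) * e s (f b))) - e p w * (r a b * (e s (f a) * e q (f b)))
      + e q w * (r a b * (e s (f a) * e p (f b))) - e q w * (r a b * (e p (f a) * e s (f b))))"
    by (simp add: covector_wedge_3 algebra_simps)
  also have "\<dots> = e s w * r p q - e s w * r q p + e p w * r q s - e p w * r s q + e q w * r s p - e q w * r p s"
    by (simp only: sum.distrib sum_subtractf sum_distrib_left[symmetric] D)
  finally show ?thesis by (simp add: algebra_simps)
qed

lemma g2_standard_contraction:
  assumes f: "dual_frame e f" and skew: "\<And>i j. r j i = - r i j"
  shows "(\<Sum>a\<in>UNIV. \<Sum>b\<in>UNIV. r a b * g2_standard e [f a, f b, w]) =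
     2 * ((r 2 7 + r 3 5 - r 4 6) * e 1 w - (r 1 7 + r 3 6 + r 4 5) * e 2 w
        - (r 1 5 - r 2 6 - r 4 7) * e 3 w + (r 1 6 + r 2 5 - r 3 7) * e 4 w
        + (r 1 3 - r 2 4 + r 6 7) * e 5 w - (r 1 4 + r 2 3 + r 5 7) * e 6 w
        + (r 1 2 + r 3 4 + r 5 6) * e 7 w)"
  unfolding g2_standard_def distrib_left right_diff_distrib sum.distrib sum_subtractf
    covector_wedge_contraction[OF f]
  using skew[of 1 2] skew[of 1 3] skew[of 1 4] skew[of 1 5] skew[of 1 6] skew[of 1 7]
    skew[of 2 3] skew[of 2 4] skew[of 2 5] skew[of 2 6] skew[of 2 7] skew[of 3 4] skew[of 3 5]
    skew[of 3 6] skew[of 3 7] skew[of 4 5] skew[of 4 6] skew[of 4 7] skew[of 5 6] skew[of 5 7] skew[of 6 7]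
  by (simp add: algebra_simps)

text \<open>Evaluation on the dual frame isolates the seven coefficients. They involve each of the
  21 index pairs exactly once, so they cut out a 14-dimensional space of skew \<open>r\<close>, the
  copy of \<open>g_2\<close> inside the 2-forms.\<close>

lemma g2_standard_contraction_eq_0_iff:
  assumes f: "dual_frame e f" and skew: "\<And>i j. r j i = - r i j"
  shows "(\<forall>k. (\<Sum>a\<in>UNIV. \<Sum>b\<in>UNIV. r a b * g2_standard e [f a, f b, f k]) = 0) \<longleftrightarrow>
     r 2 7 + r 3 5 - r 4 6 = 0 \<and> r 1 7 + r 3 6 + r 4 5 = 0 \<and>
     r 1 5 - r 2 6 - r 4 7 = 0 \<and> r 1 6 + r 2 5 - r 3 7 = 0 \<and>
     r 1 3 - r 2 4 + r 6 7 = 0 \<and> r 1 4 + r 2 3 + r 5 7 = 0 \<and>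
     r 1 2 + r 3 4 + r 5 6 = 0"
proof -
  have "e i (f j) = (if i = j then 1 else 0)" for i j
    using f by (simp add: dual_frame_def)
  then show ?thesis
    unfolding g2_standard_contraction[OF f skew] forall_7 by simp linarith
qed

text \<open>A skew \<open>K\<close> that annihilates the standard form as a derivation lies in the
  Lie algebra of its stabiliser. Each equation of that algebra is the derivation identity on one
  suitable triple of frame vectors.\<close>

lemma g2_standard_derivation:
  assumes f: "dual_frame e f" and r: "\<And>i j. e j (K (f i)) = r i j" and skew: "\<And>i j. r j i = - r i j"
    and K: "\<And>a b c. g2_standard e [K a, b, c] + g2_standard e [a, K b, c] + g2_standard e [a, b, K c] = 0"
  shows "(\<Sum>a\<in>UNIV. \<Sum>b\<in>UNIV. r a b * g2_standard e [f a, f b, f k]) = 0"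
proof -
  have ef: "e i (f j) = (if i = j then 1 else 0)" for i j
    using f by (simp add: dual_frame_def)
  have rr: "r i i = 0" for i using skew[of i i] by simp
  note flip = skew[of 1 2] skew[of 1 3] skew[of 1 4] skew[of 1 5] skew[of 1 6] skew[of 1 7]
    skew[of 2 3] skew[of 2 4] skew[of 2 5] skew[of 2 6] skew[of 2 7] skew[of 3 4] skew[of 3 5]
    skew[of 3 6] skew[of 3 7] skew[of 4 5] skew[of 4 6] skew[of 4 7] skew[of 5 6] skew[of 5 7]
    skew[of 6 7]
  note s = g2_standard_def covector_wedge_3 ef r rr flip
  \<comment> \<open>On a triple that is no line of the Fano plane, each of the three terms of \<open>K\<close> reduces to one
    entry of \<open>r\<close>.\<close>
  have "r 2 7 + r 3 5 - r 4 6 = 0"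
    using K[of "f 2" "f 3" "f 4"] by (simp add: s)
  moreover have "r 1 7 + r 3 6 + r 4 5 = 0"
    using K[of "f 1" "f 3" "f 4"] by (simp add: s)
  moreover have "r 1 5 - r 2 6 - r 4 7 = 0"
    using K[of "f 1" "f 2" "f 4"] by (simp add: s)
  moreover have "r 1 6 + r 2 5 - r 3 7 = 0"
    using K[of "f 1" "f 2" "f 3"] by (simp add: s)
  moreover have "r 1 3 - r 2 4 + r 6 7 = 0"
    using K[of "f 1" "f 2" "f 6"] by (simp add: s)
  moreover have "r 1 4 + r 2 3 + r 5 7 = 0"
    using K[of "f 1" "f 2" "f 5"] by (simp add: s)
  moreover have "r 1 2 + r 3 4 + r 5 6 = 0"
    using K[of "f 1" "f 4" "f 5"] by (simp add: s)
  ultimately show ?thesis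
    using g2_standard_contraction_eq_0_iff[of e f r, OF f skew] by blast
qed

section \<open>Curvature and the \<open>G\<^sub>2\<close> form\<close>

lemma ext_deriv_3_alternating:
  assumes U: "open U" "x \<in> U"
    and form: "\<And>y. y \<in> U \<Longrightarrow> multilinear 3 (T y)" "\<And>y. y \<in> U \<Longrightarrow> alternating 3 (T y)"
    and d: "\<And>u v w. (\<lambda>y. T y [u, v, w]) differentiable at x"
  shows "linear (\<lambda>a. ext_deriv T x [a, b, c, d])"
    "ext_deriv T x [a, b, c, d] = - ext_deriv T x [b, a, c, d]"
    "ext_deriv T x [a, b, c, d] = - ext_deriv T x [a, c, b, d]"
    "ext_deriv T x [a, b, c, d] = - ext_deriv T x [a, b, d, c]"
proof -
  note swap = frechet_derivative_form_swap[OF U form d]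
  have "linear (\<lambda>a. T y [a, b, c])" if "y \<in> U" for y b c
    using multilinear_slot[OF form(1)[OF that], of "[a, b, c]" 0 for a] by simp
  note l = frechet_derivative_linear_slot[OF U this d]
  have "linear (\<lambda>a. frechet_derivative (\<lambda>y. T y [b, c, d]) (at x) a)"
    using d frechet_derivative_works has_derivative_linear by blast
  then show "linear (\<lambda>a. ext_deriv T x [a, b, c, d])"
    unfolding ext_deriv_3 by (intro linear_compose_add linear_compose_sub l)
  show "ext_deriv T x [a, b, c, d] = - ext_deriv T x [b, a, c, d]"
    using swap(1)[of a b d c] swap(1)[of a b c d] by (simp add: ext_deriv_3)
  show "ext_deriv T x [a, b, c, d] = - ext_deriv T x [a, c, b, d]"
    using swap(1)[of b c d a] swap(2)[of a b c d] by (simp add: ext_deriv_3)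
  show "ext_deriv T x [a, b, c, d] = - ext_deriv T x [a, b, d, c]"
    using swap(2)[of b c d a] swap(2)[of a c d b] by (simp add: ext_deriv_3)
qed

text \<open>Frame vectors are replaced by arbitrary vectors one place at a time; transpositions move
  the place concerned to the front, where linearity is available.\<close>

lemma alternating4_eq_0_on_frame:
  fixes s :: "coord7 \<Rightarrow> coord7 \<Rightarrow> coord7 \<Rightarrow> coord7 \<Rightarrow> real"
  assumes f: "dual_frame e f" and lin: "\<And>b c d. linear (\<lambda>a. s a b c d)"
    and s12: "\<And>a b c d. s a b c d = - s b a c d"
    and s23: "\<And>a b c d. s a b c d = - s a c b d"
    and s34: "\<And>a b c d. s a b c d = - s a b d c"
    and z: "\<And>i j k l. s (f i) (f j) (f k) (f l) = 0"
  shows "s a b c d = 0"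
proof -
  note ext = linear_eq_0_on_frame[OF f lin]
  have 1: "s a (f j) (f k) (f l) = 0" for a j k l
    by (rule ext) (rule z)
  have 2: "s a b (f k) (f l) = 0" for a b k l
    by (rule ext) (use 1 s12[of "f _" b] in simp)
  have 3: "s a b c (f l) = 0" for a b c l
    by (rule ext) (use 2 s12[of "f _" b] s23[of b "f _" c] in simp)
  show ?thesis
    by (rule ext) (use 3 s12[of "f _" b] s23[of b "f _" c] s34[of b c "f _" d] in simp)
qed

context chart_metric_connection
begin

text \<open>Linearity in \<open>z\<close> is inherited from linearity in \<open>w\<close> through
  \<open>curvature_skew\<close>, without a return to the derivatives of
  \<open>\<Gamma>\<close>.\<close>

lemma curvature_linear:
  assumes "x \<in> U"
  shows "linear (\<lambda>w. curvature_tensor g \<Gamma> x u v z w)" "linear (\<lambda>z. curvature_tensor g \<Gamma> x u v z w)"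
proof -
  show 1: "linear (\<lambda>w. curvature_tensor g \<Gamma> x u v z w)" for z
    using g_linear[OF assms] unfolding curvature_tensor_def by (simp only: g_sym[OF assms, of "curvature _ _ _ _ _"])
  show "linear (\<lambda>z. curvature_tensor g \<Gamma> x u v z w)"
    using linear_compose_neg[OF 1[of w]] by (subst curvature_skew[OF assms])
qed

text \<open>The curvature endomorphism \<open>K\<close> annihilates \<open>\<phi>\<close> as a
  derivation, so \<open>g2_standard_derivation\<close> applies in the frame dual to
  \<open>e\<close>. Linearity frees \<open>w\<close>, and a change of frame leads to
  \<open>h\<close>.\<close>

lemma parallel_g2_curvature:
  assumes x: "x \<in> U" and ml: "\<And>y. y \<in> U \<Longrightarrow> multilinear 3 (\<phi> y)"
    and sm: "\<And>vs. length vs = 3 \<Longrightarrow> smooth_on U (\<lambda>y. \<phi> y vs)"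
    and par: "\<And>y u vs. y \<in> U \<Longrightarrow> length vs = 3 \<Longrightarrow> cov_deriv_tensor \<Gamma> \<phi> y u vs = 0"
    and e: "adapted_coframe (\<phi> x) e" and g: "\<And>u v. g x [u, v] = (\<Sum>i\<in>UNIV. e i u * e i v)"
    and h: "orthonormal_frame (g x) h"
  shows "(\<Sum>a\<in>UNIV. \<Sum>b\<in>UNIV. curvature_tensor g \<Gamma> x u v (h a) (h b) * \<phi> x [h a, h b, w]) = 0"
proof -
  obtain f where f: "dual_frame e f"
    using e coframe_has_dual_frame by (auto simp: adapted_coframe_def)
  have ef: "e i (f j) = (if i = j then 1 else 0)" for i j
    using f by (simp add: dual_frame_def)
  have \<phi>: "\<phi> x [a, b, c] = g2_standard e [a, b, c]" for a b c
    using e by (simp add: adapted_coframe_def)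
  have l: "linear (\<lambda>a. \<phi> x [a, b, c])" "linear (\<lambda>b. \<phi> x [a, b, c])" "linear (\<lambda>c. \<phi> x [a, b, c])" for a b c
    using multilinear_slot[OF ml[OF x], of "[a, b, c]" 0] multilinear_slot[OF ml[OF x], of "[a, b, c]" 1]
      multilinear_slot[OF ml[OF x], of "[a, b, c]" 2] by (simp_all add: numeral_2_eq_2)
  note R = curvature_linear[OF x]
  define K where "K z = curvature \<Gamma> (\<lambda>_. u) (\<lambda>_. v) (\<lambda>_. z) x" for z
  \<comment> \<open>Since \<open>e\<close> diagonalises \<open>g\<close>, its dual frame is
    orthonormal, and the components of \<open>K\<close> are values of the lowered curvature.\<close>
  have r: "e j (K (f i)) = curvature_tensor g \<Gamma> x u v (f i) (f j)" for i j
    by (simp add: curvature_tensor_def g K_def ef if_distrib[of "\<lambda>x. _ * x"] cong: if_cong)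
  have "g2_standard e [K a, b, c] + g2_standard e [a, K b, c] + g2_standard e [a, b, K c] = 0" for a b c
    using curvature_derivation[OF x ml sm par] by (simp add: K_def flip: \<phi>)
  from g2_standard_derivation[OF f r curvature_skew[OF x] this]
  have frame: "(\<Sum>a\<in>UNIV. \<Sum>b\<in>UNIV. curvature_tensor g \<Gamma> x u v (f a) (f b) * \<phi> x [f a, f b, f k]) = 0" for k
    by (simp add: \<phi>)
  have "(\<Sum>a\<in>UNIV. \<Sum>b\<in>UNIV. curvature_tensor g \<Gamma> x u v (f a) (f b) * \<phi> x [f a, f b, w]) = 0"
  proof (rule linear_eq_0_on_frame[OF f])
    show "linear (\<lambda>w. \<Sum>a\<in>UNIV. \<Sum>b\<in>UNIV. curvature_tensor g \<Gamma> x u v (f a) (f b) * \<phi> x [f a, f b, w])"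
      by (rule linearI) (simp_all add: linear_add[OF l(3)] linear_scale[OF l(3)] distrib_left
          sum.distrib sum_distrib_left mult.left_commute)
  qed (rule frame)
  moreover have "(\<Sum>a\<in>UNIV. \<Sum>b\<in>UNIV. curvature_tensor g \<Gamma> x u v (h a) (h b) * \<phi> x [h a, h b, w]) =
      (\<Sum>a\<in>UNIV. \<Sum>b\<in>UNIV. curvature_tensor g \<Gamma> x u v (f a) (f b) * \<phi> x [f a, f b, w])"
  proof -
    \<comment> \<open>The two summation indices change frame one at a time; \<open>sum.swap\<close>
      brings each to the inside.\<close>
    note contr = orthonormal_frame_contraction[OF f g h]
    have "(\<Sum>a\<in>UNIV. \<Sum>b\<in>UNIV. curvature_tensor g \<Gamma> x u v (h a) (h b) * \<phi> x [h a, h b, w]) =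
        (\<Sum>a\<in>UNIV. \<Sum>b\<in>UNIV. curvature_tensor g \<Gamma> x u v (h a) (f b) * \<phi> x [h a, f b, w])"
      by (intro sum.cong refl contr R l)
    also have "\<dots> = (\<Sum>b\<in>UNIV. \<Sum>a\<in>UNIV. curvature_tensor g \<Gamma> x u v (h a) (f b) * \<phi> x [h a, f b, w])"
      by (rule sum.swap)
    also have "\<dots> = (\<Sum>b\<in>UNIV. \<Sum>a\<in>UNIV. curvature_tensor g \<Gamma> x u v (f a) (f b) * \<phi> x [f a, f b, w])"
      by (intro sum.cong refl contr R l)
    also have "\<dots> = (\<Sum>a\<in>UNIV. \<Sum>b\<in>UNIV. curvature_tensor g \<Gamma> x u v (f a) (f b) * \<phi> x [f a, f b, w])"
      by (rule sum.swap)
    finally show ?thesis .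
  qed
  ultimately show ?thesis by simp
qed

end

section \<open>The equivalence at a point and on the manifold\<close>

lemma hull_instanton_iff_closed_at:
  assumes "chart_metric_connection U g \<Gamma>" "chart_metric_connection U g \<Gamma>h" and x: "x \<in> U"
    and T: "\<And>y u v w. y \<in> U \<Longrightarrow> torsion_tensor g \<Gamma> y [u, v, w] = T y [u, v, w]"
    and Th: "\<And>y u v w. y \<in> U \<Longrightarrow> torsion_tensor g \<Gamma>h y [u, v, w] = - T y [u, v, w]"
    and form: "\<And>y. y \<in> U \<Longrightarrow> multilinear 3 (T y)" "\<And>y. y \<in> U \<Longrightarrow> alternating 3 (T y)"
    and Td: "\<And>u v w. (\<lambda>y. T y [u, v, w]) differentiable at x"
    and ml: "\<And>y. y \<in> U \<Longrightarrow> multilinear 3 (\<phi> y)"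
    and sm: "\<And>vs. length vs = 3 \<Longrightarrow> smooth_on U (\<lambda>y. \<phi> y vs)"
    and par: "\<And>y u vs. y \<in> U \<Longrightarrow> length vs = 3 \<Longrightarrow> cov_deriv_tensor \<Gamma> \<phi> y u vs = 0"
    and e: "adapted_coframe (\<phi> x) e" and g: "\<And>u v. g x [u, v] = (\<Sum>i\<in>UNIV. e i u * e i v)"
  shows "(\<forall>h. orthonormal_frame (g x) h \<longrightarrow> (\<forall>i j k. (\<Sum>a\<in>UNIV. \<Sum>b\<in>UNIV.
           curvature_tensor g \<Gamma>h x (h a) (h b) (h i) (h j) * \<phi> x [h a, h b, h k]) = 0)) \<longleftrightarrow>
         (\<forall>vs. length vs = 4 \<longrightarrow> ext_deriv T x vs = 0)"
    (is "?instanton \<longleftrightarrow> ?closed")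
proof -
  interpret G: chart_metric_connection U g \<Gamma> by fact
  have dT: "ext_deriv T x [u, v, z, w] =
      2 * (curvature_tensor g \<Gamma> x u v z w - curvature_tensor g \<Gamma>h x z w u v)" for u v z w
    by (rule curvature_pair_difference[OF assms(1,2) x T Th form Td])
  have R0: "(\<Sum>a\<in>UNIV. \<Sum>b\<in>UNIV. curvature_tensor g \<Gamma> x u v (h a) (h b) * \<phi> x [h a, h b, w]) = 0"
    if "orthonormal_frame (g x) h" for u v w h
    by (rule G.parallel_g2_curvature[OF x ml sm par e g that])
  note alt = ext_deriv_3_alternating[of U x T, OF G.open_U x form Td]
  show ?thesis
  proof
    assume inst: ?instanton
    obtain f where f: "dual_frame e f"
      using e coframe_has_dual_frame by (auto simp: adapted_coframe_def)
    then have on: "orthonormal_frame (g x) f"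
      by (simp add: orthonormal_frame_def dual_frame_def g if_distrib[of "\<lambda>x. _ * x"] cong: if_cong)
    define s where "s i j k l = ext_deriv T x [f i, f j, f k, f l]" for i j k l
    have skew: "s i j k l = - s j i k l" "s i j k l = - s i k j l" "s i j k l = - s i j l k" for i j k l
      unfolding s_def by (rule alt, assumption, assumption)+
    have "(\<Sum>a\<in>UNIV. \<Sum>b\<in>UNIV. s i j a b * g2_standard e [f a, f b, f k]) = 0" for i j k
    proof -
      \<comment> \<open>By \<open>dT\<close> the contraction splits in two: the part from
        \<open>\<Gamma>\<close> vanishes because \<open>\<phi>\<close> is parallel, the part from
        \<open>\<Gamma>h\<close> by the instanton condition.\<close>
      have "(\<Sum>a\<in>UNIV. \<Sum>b\<in>UNIV. s i j a b * \<phi> x [f a, f b, f k]) =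
         2 * (\<Sum>a\<in>UNIV. \<Sum>b\<in>UNIV. curvature_tensor g \<Gamma> x (f i) (f j) (f a) (f b) * \<phi> x [f a, f b, f k])
       - 2 * (\<Sum>a\<in>UNIV. \<Sum>b\<in>UNIV. curvature_tensor g \<Gamma>h x (f a) (f b) (f i) (f j) * \<phi> x [f a, f b, f k])"
        by (simp add: s_def dT sum_distrib_left algebra_simps flip: sum_subtractf)
      also have "\<dots> = 0"
        using R0[OF on] inst on by simp
      finally show ?thesis
        using e by (simp add: adapted_coframe_def)
    qed
    then have eqs: "s i j 2 7 + s i j 3 5 - s i j 4 6 = 0 \<and> s i j 1 7 + s i j 3 6 + s i j 4 5 = 0 \<and>
        s i j 1 5 - s i j 2 6 - s i j 4 7 = 0 \<and> s i j 1 6 + s i j 2 5 - s i j 3 7 = 0 \<and>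
        s i j 1 3 - s i j 2 4 + s i j 6 7 = 0 \<and> s i j 1 4 + s i j 2 3 + s i j 5 7 = 0 \<and>
        s i j 1 2 + s i j 3 4 + s i j 5 6 = 0" for i j
      using g2_standard_contraction_eq_0_iff[of e f "s i j", OF f skew(3)] by blast
    have "s i j k l = 0" for i j k l
      by (rule skew4_eq_0[OF skew]) (use eqs in blast)+
    then have "ext_deriv T x [a, b, c, d] = 0" for a b c d
      using alternating4_eq_0_on_frame[OF f alt] unfolding s_def by blast
    then show ?closed
      by (auto simp: length_Suc_conv eval_nat_numeral)
  next
    assume closed: ?closed
    \<comment> \<open>Closedness matches the first argument pair of the curvature of
      \<open>\<Gamma>h\<close> with the last pair of that of \<open>\<Gamma>\<close>, whose
      contraction vanishes in every orthonormal frame.\<close>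
    have "curvature_tensor g \<Gamma>h x z w u v = curvature_tensor g \<Gamma> x u v z w" for u v z w
      using dT[of u v z w] closed by simp
    then show ?instanton using R0 by simp
  qed
qed

text \<open>The properties of \<open>g\<close> itself are read off from a smooth adapted coframe on
  a neighbourhood \<open>N\<close>, where \<open>g\<close> is the sum of the squares of its
  members.\<close>

lemma chart_metric_connectionI:
  assumes A: "smooth_manifold7 M A" "c \<in> A" and \<phi>: "g2_structure A \<phi>"
    and g: "g2_metric_volume A \<phi> g vol" and \<Gamma>: "metric_connection A g \<Gamma>"
  shows "chart_metric_connection (chart_image c) (g c) (\<Gamma> c)"
proof (rule chart_metric_connection.intro)
  show "open (chart_image c)" using A by (simp add: smooth_manifold7_def)
  fix y assume y: "y \<in> chart_image c"
  obtain N e where N: "open N" "y \<in> N" "N \<subseteq> chart_image c"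
    and sm: "\<And>i v. smooth_on N (\<lambda>y. e y i v)" and ad: "\<And>y. y \<in> N \<Longrightarrow> adapted_coframe (\<phi> c y) (e y)"
    using \<phi> A(2) y unfolding g2_structure_def by meson
  have gN: "g c z [u, v] = (\<Sum>i\<in>UNIV. e z i u * e z i v)" if "z \<in> N" for z u v
    using g A(2) N(3) ad[OF that] that unfolding g2_metric_volume_def by blast
  have lin: "linear (e y i)" and inj: "(\<And>i. e y i v = 0) \<Longrightarrow> v = 0" for i v
    using ad[OF N(2)] by (auto simp: adapted_coframe_def coframe_def)
  show "linear (\<lambda>u. g c y [u, v])" for v
    unfolding gN[OF N(2)]
    by (rule linearI) (simp_all add: linear_add[OF lin] linear_scale[OF lin] distrib_right sum.distrib
        sum_distrib_left mult.assoc)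
  show "g c y [u, v] = g c y [v, u]" for u v
    by (simp add: gN[OF N(2)] mult.commute)
  show "u = 0" if "g c y [u, u] = 0" for u
    using that by (intro inj) (simp add: gN[OF N(2)] sum_nonneg_eq_0_iff)
  show "(\<lambda>y. g c y [u, v]) differentiable at y" for u v
  proof (rule differentiable_cong_open[OF N(1,2)])
    show "(\<lambda>z. \<Sum>i\<in>UNIV. e z i u * e z i v) differentiable at y"
      using smooth_on_differentiable[OF sm N(2)]
      by (intro differentiable_sum ballI differentiable_mult) auto
  qed (simp add: gN)
  show "bilinear (\<Gamma> c y)"
    using \<Gamma> A(2) y by (simp add: metric_connection_def connection_def)
  show "(\<lambda>y. \<Gamma> c y u v) differentiable at y" for u v
    using \<Gamma> A(2) by (intro smooth_on_differentiable[OF _ y]) (simp add: metric_connection_def connection_def)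
  show "cov_deriv_tensor (\<Gamma> c) (g c) y u [v, w] = 0" for u v w
    using \<Gamma> A(2) y by (simp add: metric_connection_def parallel_def)
qed

theorem theorem5p3:
  fixes M :: "'m topology" and A :: "'m chart set"
    and \<phi> g vol T :: "'m chart \<Rightarrow> field"
    and \<Gamma> \<Gamma>h :: "'m chart \<Rightarrow> christoffel"
  assumes "smooth_manifold7 M A"
    and "g2_structure A \<phi>"
    and "g2_metric_volume A \<phi> g vol"
    and "integrable_g2 A \<phi> g vol"
    and "characteristic_connection A \<phi> g \<Gamma> T"
    and "g2_hull_connection A g T \<Gamma>h"
  shows "g2_instanton A \<phi> g \<Gamma>h \<longleftrightarrow> closed_form A 3 T"
proof -
  have pointwise: "(\<forall>h. orthonormal_frame (g c x) h \<longrightarrow> (\<forall>i j k. (\<Sum>a\<in>UNIV. \<Sum>b\<in>UNIV.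
        curvature_tensor (g c) (\<Gamma>h c) x (h a) (h b) (h i) (h j) * \<phi> c x [h a, h b, h k]) = 0)) \<longleftrightarrow>
      (\<forall>vs. length vs = 4 \<longrightarrow> ext_deriv (T c) x vs = 0)" if c: "c \<in> A" and x: "x \<in> chart_image c" for c x
  proof -
    have "metric_connection A g \<Gamma>" "metric_connection A g \<Gamma>h"
      using assms(5,6) by (simp_all add: characteristic_connection_def g2_hull_connection_def)
    note conn = this[THEN chart_metric_connectionI[OF assms(1) c assms(2,3)]]
    have T: "differential_form A 3 T"
      using assms(5) by (simp add: characteristic_connection_def)
    have \<phi>: "differential_form A 3 \<phi>"
      using assms(2) by (simp add: g2_structure_def)
    obtain e where e: "adapted_coframe (\<phi> c x) e"
      using assms(2) c x unfolding g2_structure_def by meson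
    show ?thesis
    proof (rule hull_instanton_iff_closed_at[OF conn x])
      show "adapted_coframe (\<phi> c x) e" by fact
      show "g c x [u, v] = (\<Sum>i\<in>UNIV. e i u * e i v)" for u v
        using assms(3) c x e by (auto simp: g2_metric_volume_def)
      show "(\<lambda>y. T c y [u, v, w]) differentiable at x" for u v w
        using T c by (intro smooth_on_differentiable[OF _ x]) (simp add: differential_form_def tensor_field_def)
      show "smooth_on (chart_image c) (\<lambda>y. \<phi> c y vs)" if "length vs = 3" for vs
        using \<phi> c that by (simp add: differential_form_def tensor_field_def)
      fix y assume y: "y \<in> chart_image c"
      show "torsion_tensor (g c) (\<Gamma> c) y [u, v, w] = T c y [u, v, w]" for u v w
        using assms(5) c y by (simp add: characteristic_connection_def)
      show "torsion_tensor (g c) (\<Gamma>h c) y [u, v, w] = - T c y [u, v, w]" for u v w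
        using assms(6) c y by (simp add: g2_hull_connection_def)
      show "multilinear 3 (T c y)" "alternating 3 (T c y)"
        using T c y by (simp_all add: differential_form_def tensor_field_def)
      show "multilinear 3 (\<phi> c y)"
        using \<phi> c y by (simp add: differential_form_def tensor_field_def)
      show "cov_deriv_tensor (\<Gamma> c) (\<phi> c) y u vs = 0" if "length vs = 3" for u vs
        using assms(5) c y that by (simp add: characteristic_connection_def parallel_def)
    qed
  qed
  \<comment> \<open>Both conditions quantify over the same charts and points.
    \<open>closed_form\<close> speaks of lists of length \<open>Suc 3\<close>, the pointwise
    statement of lists of length 4.\<close>
  then show ?thesis
    unfolding g2_instanton_def closed_form_def by (simp add: eval_nat_numeral)
qed

end
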